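(* Let $u$ be a smooth solution on $[0,T]$ of the rotating Euler equations $$\partial_t u + u\cdot\nabla u + \nabla\pi + 2\Omega\, e_3\times u = 0,\qquad \nabla\cdot u = 0,$$ in $R$ with $u\cdot n=0$ on $\partial R$ and $\int_0^T\|\nabla u(\cdot,t)\|_{L^\infty}\,dt<\infty$. Consider, at time $t_0\in[0,T]$, two particles $P=(a,b,c)$ and $Q=(a,b,c+d)$ separated by a vertical segment (in $R$) of length $d>0$, and consider the Lagrangian evolution of the particles $X(P,t)$, $X(Q,t)$, starting from $P$, $Q$ at time $t_0$. Then the vertical separation between the two particles obeys $$\left|X_3(P,t)-X_3(Q,t)+d\right|\le\frac{\rho\, d}{2}\left(1+e^{2\int_{t_0}^t\|\nabla u(\cdot,t')\|_{L^\infty(dx)}\,dt'}\right)$$ for all $t_0\le t\le T$, where $$\rho=\frac{\sup_{0\le t\le T}\|\nabla\times u(\cdot,t)\|_{L^\infty(dx)}}{\Omega}.$$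
   Context: $\Omega>0$ is a constant (angular velocity) and $e_3$ is the unit vector of the third Cartesian direction (the rotation axis); "vertical" refers to this direction. $R\subset\mathbb R^3$ is an open domain with smooth boundary $\partial R$ and normal $n$. The Lagrangian path map started at time $t_0$ is the solution of $\partial_t X(p,t)=u(X(p,t),t)$, $X(p,t_0)=p$. It is assumed that $\sup_{0\le t\le T}\|\nabla\times u(\cdot,t)\|_{L^\infty}<\infty$. $\|\nabla u\|_{L^\infty}$ is the supremum over $x$ of the Euclidean operator norm of the matrix $\nabla u$. *)

theory Defs
  imports "HOL-Analysis.Analysis"
begin

text \<open>
  \<open>Ck_on k U f\<close> is intended for open \<open>U\<close>. On an arbitrary set, smoothness means local
  extendability to smooth functions on open sets; for a function on
  \<open>{0..T} \<times> closure R\<close> this is smoothness up to the boundary in space and time.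
\<close>

primrec Ck_on ::
  "nat \<Rightarrow> 'a::euclidean_space set \<Rightarrow> ('a \<Rightarrow> 'b::euclidean_space) \<Rightarrow> bool" where
  "Ck_on 0 U f \<longleftrightarrow> continuous_on U f"
| "Ck_on (Suc k) U f \<longleftrightarrow>
     f differentiable_on U \<and> (\<forall>v. Ck_on k U (\<lambda>x. frechet_derivative f (at x) v))"

definition smooth_on_open ::
  "'a::euclidean_space set \<Rightarrow> ('a \<Rightarrow> 'b::euclidean_space) \<Rightarrow> bool" where
  "smooth_on_open U f \<longleftrightarrow> open U \<and> (\<forall>k. Ck_on k U f)"

definition smooth_on ::
  "'a::euclidean_space set \<Rightarrow> ('a \<Rightarrow> 'b::euclidean_space) \<Rightarrow> bool" where
  "smooth_on A f \<longleftrightarrow>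
     (\<forall>z\<in>A. \<exists>U g. z \<in> U \<and> smooth_on_open U g \<and> (\<forall>y\<in>U \<inter> A. g y = f y))"

definition grad :: "(real^3 \<Rightarrow> real) \<Rightarrow> real^3 \<Rightarrow> real^3" where
  "grad f x = (\<chi> i. frechet_derivative f (at x) (axis i 1))"

definition divergence :: "(real^3 \<Rightarrow> real^3) \<Rightarrow> real^3 \<Rightarrow> real" where
  "divergence v x = trace (jacobian v (at x))"

text \<open>In \<open>jacobian v (at x)\<close>, the entry \<open>$ i $ j\<close> is the \<open>j\<close>-th partial derivative of \<open>v\<^sub>i\<close>.\<close>

definition curl :: "(real^3 \<Rightarrow> real^3) \<Rightarrow> real^3 \<Rightarrow> real^3" where
  "curl v x = (let J = jacobian v (at x) in
     vector [J $ 3 $ 2 - J $ 2 $ 3, J $ 1 $ 3 - J $ 3 $ 1, J $ 2 $ 1 - J $ 1 $ 2])"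

text \<open>
  A local defining function of \<open>R\<close> near a boundary point \<open>p\<close>. The sign and the nonvanishing
  gradient force \<open>frontier R \<inter> U = {x \<in> U. \<phi> x = 0}\<close>, with \<open>R\<close> on one side only.
\<close>

definition defining_function ::
  "(real^3) set \<Rightarrow> real^3 \<Rightarrow> (real^3) set \<Rightarrow> (real^3 \<Rightarrow> real) \<Rightarrow> bool" where
  "defining_function R p U \<phi> \<longleftrightarrow>
     p \<in> U \<and> smooth_on_open U \<phi> \<and> (\<forall>x\<in>U. grad \<phi> x \<noteq> 0) \<and> R \<inter> U = {x \<in> U. \<phi> x < 0}"

definition smooth_boundary :: "(real^3) set \<Rightarrow> bool" where
  "smooth_boundary R \<longleftrightarrow> (\<forall>p\<in>frontier R. \<exists>U \<phi>. defining_function R p U \<phi>)"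

definition outward_unit_normal :: "(real^3) set \<Rightarrow> (real^3 \<Rightarrow> real^3) \<Rightarrow> bool" where
  "outward_unit_normal R n \<longleftrightarrow>
     (\<forall>p\<in>frontier R. \<forall>U \<phi>. defining_function R p U \<phi> \<longrightarrow>
        n p = grad \<phi> p /\<^sub>R norm (grad \<phi> p))"

text \<open>
  Suprema are taken in \<open>ennreal\<close>, so an unbounded function has norm \<open>\<infinity>\<close>. For continuous
  functions on an open set the supremum is the essential supremum.
\<close>

definition Linf_norm :: "(real^3) set \<Rightarrow> (real^3 \<Rightarrow> real^3) \<Rightarrow> ennreal" where
  "Linf_norm R v = (SUP x\<in>R. ennreal (norm (v x)))"

definition Linf_norm_jacobian :: "(real^3) set \<Rightarrow> (real^3 \<Rightarrow> real^3) \<Rightarrow> ennreal" where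
  "Linf_norm_jacobian R v = (SUP x\<in>R. ennreal (onorm ((*v) (jacobian v (at x)))))"

text \<open>
  The pressure is only required to have a spatial gradient; the equation then makes that
  gradient as smooth as the remaining terms. At \<open>0\<close> and \<open>T\<close> the time derivative is one-sided.
\<close>

definition rotating_euler_solution ::
  "real \<Rightarrow> real \<Rightarrow> (real^3) set \<Rightarrow> (real \<Rightarrow> real^3 \<Rightarrow> real^3) \<Rightarrow> (real \<Rightarrow> real^3 \<Rightarrow> real) \<Rightarrow> bool"
  where
  "rotating_euler_solution \<Omega> T R u \<pi> \<longleftrightarrow>
     smooth_on ({0..T} \<times> closure R) (\<lambda>(t, x). u t x) \<and>
     (\<forall>t\<in>{0..T}. \<pi> t differentiable_on R) \<and>
     (\<forall>t\<in>{0..T}. \<forall>x\<in>R.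
        vector_derivative (\<lambda>s. u s x) (at t within {0..T})
          + jacobian (u t) (at x) *v u t x
          + grad (\<pi> t) x
          + (2 * \<Omega>) *\<^sub>R cross3 (axis 3 1) (u t x) = 0 \<and>
        divergence (u t) x = 0)"

text \<open>
  Trajectories start in \<open>R\<close> and are only required to stay where \<open>u\<close> is defined, namely in
  \<open>closure R\<close>.
\<close>

definition lagrangian_path_map ::
  "(real^3) set \<Rightarrow> (real \<Rightarrow> real^3 \<Rightarrow> real^3) \<Rightarrow> real \<Rightarrow> real \<Rightarrow> (real^3 \<Rightarrow> real \<Rightarrow> real^3) \<Rightarrow> bool"
  where
  "lagrangian_path_map R u t0 T X \<longleftrightarrow>
     (\<forall>p\<in>R. X p t0 = p \<and>
        (\<forall>t\<in>{t0..T}. X p t \<in> closure R \<and>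
           (X p has_vector_derivative u t (X p t)) (at t within {t0..T})))"

end

theory Submission
  imports Defs
begin

text \<open>
  The absolute vorticity \<open>\<zeta> = curl u + 2 \<Omega> e\<^sub>3\<close> is frozen into the flow: taking the curl of the
  momentum equation (which removes the pressure, by symmetry of its second derivatives) and using
  incompressibility shows that along every trajectory \<open>x\<close> the vector \<open>z t = \<zeta> (t, x t)\<close> solves
  \<open>z' = \<nabla>u z\<close> (\<open>vorticity_transport\<close>). The separation \<open>\<delta>\<close> of two trajectories that start at a small vertical distance
  \<open>h\<close> solves the same linear equation up to an error \<open>o(h)\<close>. Hence so does
  \<open>e = h / (2 \<Omega>) z - \<delta>\<close>. Initially \<open>\<delta> = h e\<^sub>3\<close>, so the contribution \<open>2 \<Omega> e\<^sub>3\<close> of the rotation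
  cancels \<open>\<delta>\<close> exactly, and \<open>e\<close> starts at \<open>h / (2 \<Omega>) curl u\<close>, whose norm is at most \<open>\<rho> h / 2\<close>.
  Gronwall's inequality bounds \<open>e\<close> at later times by \<open>\<rho> h / 2\<close> times the exponential of
  \<open>\<integral> \<parallel>\<nabla>u\<parallel>\<close>. Reading off the third component, \<open>\<delta>\<^sub>3 - h\<close> is \<open>h / (2 \<Omega>)\<close> times the vertical vorticity
  minus the third component of \<open>e\<close>, so that
  \<open>\<bar>\<delta>\<^sub>3 - h\<bar> \<le> \<rho> h / 2 (1 + exp (\<integral> \<parallel>\<nabla>u\<parallel>)) + o(h)\<close>.
  This (\<open>vertical_separation_infinitesimal\<close>) is a bound on the local Lipschitz constant of \<open>s \<mapsto> X\<^sub>3 (P + s e\<^sub>3, t) - s\<close>, and such a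
  bound integrates along the vertical segment to the finite distance \<open>d\<close>
  (\<open>local_lipschitz_bound_imp_bound\<close>). Arguing with differences of trajectories instead
  of the derivative of the flow map means that only the given trajectories occur.

  Trajectories live in \<open>closure R\<close>, where \<open>u\<close> is smooth only in the sense of local extensions to
  open sets. Since \<open>{0..T} \<times> closure R\<close> is the closure of its interior, the derivatives of all
  extensions agree on it. This defines derivatives of \<open>u\<close> up to the boundary (\<open>ext_deriv\<close>), with
  the usual chain rule, symmetry of second derivatives and locally uniform linearization. The
  vorticity equation and the bounds by \<open>L\<^sup>\<infinity>\<close> norms are proved over \<open>R\<close> and pass to the closure
  by continuity.
\<close>

section \<open>One-variable estimates and symmetry of second derivatives\<close>

text \<open>
  A difference quotient bound near each single point, with no uniformity in the point and no
  differentiability, is enough for a mean value inequality: the inequality is additive under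
  concatenation of intervals, so bisection applies.
\<close>

lemma local_lipschitz_bound_imp_bound:
  fixes f :: "real \<Rightarrow> real"
  assumes "a \<le> b"
    and local: "\<And>x \<epsilon>. x \<in> {a..b} \<Longrightarrow> \<epsilon> > 0 \<Longrightarrow>
      \<exists>r>0. \<forall>y\<in>{a..b}. \<bar>y - x\<bar> < r \<longrightarrow> \<bar>f y - f x\<bar> \<le> (K + \<epsilon>) * \<bar>y - x\<bar>"
  shows "\<bar>f b - f a\<bar> \<le> K * (b - a)"
proof -
  have main: "\<bar>f b - f a\<bar> \<le> (K + \<epsilon>) * (b - a)" if \<epsilon>: "\<epsilon> > 0" for \<epsilon>
  proof -
    have "{a..b} \<subseteq> {a..b} \<longrightarrow> \<bar>f b - f a\<bar> \<le> (K + \<epsilon>) * (b - a)"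
      using \<open>a \<le> b\<close>
    proof (induction rule: Bolzano[where P = "\<lambda>p q. {p..q} \<subseteq> {a..b} \<longrightarrow> \<bar>f q - f p\<bar> \<le> (K + \<epsilon>) * (q - p)"])
      case (trans p q r)
      then show ?case by (auto simp: algebra_simps)
    next
      case (local x)
      then obtain r where r: "r > 0"
        "\<And>y. y \<in> {a..b} \<Longrightarrow> \<bar>y - x\<bar> < r \<Longrightarrow> \<bar>f y - f x\<bar> \<le> (K + \<epsilon>) * \<bar>y - x\<bar>"
        using assms(2)[of x \<epsilon>] \<epsilon> by (metis atLeastAtMost_iff)
      show ?case
      proof (intro exI[of _ r] conjI allI impI r(1))
        fix p q assume pq: "p \<le> x \<and> x \<le> q \<and> q - p < r" "{p..q} \<subseteq> {a..b}"
        have "\<bar>f p - f x\<bar> \<le> (K + \<epsilon>) * \<bar>p - x\<bar>" "\<bar>f q - f x\<bar> \<le> (K + \<epsilon>) * \<bar>q - x\<bar>"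
          by (rule r(2); use pq in auto)+
        moreover have "\<bar>p - x\<bar> = x - p" "\<bar>q - x\<bar> = q - x" using pq by auto
        ultimately show "\<bar>f q - f p\<bar> \<le> (K + \<epsilon>) * (q - p)"
          by (auto simp: algebra_simps)
      qed
    qed
    then show ?thesis by simp
  qed
  have "((\<lambda>\<epsilon>. (K + \<epsilon>) * (b - a)) \<longlongrightarrow> (K + 0) * (b - a)) (at_right 0)"
    by (intro tendsto_intros)
  then have "\<bar>f b - f a\<bar> \<le> (K + 0) * (b - a)"
    by (rule tendsto_lowerbound) (auto simp: eventually_at_right_less eventually_at_right_field intro!: exI[of _ 1] main)
  then show ?thesis by simp
qed

text \<open>
  Multiply \<open>norm e\<close> by the integrating factor \<open>exp (- \<integral> m)\<close>. Since the norm is not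
  differentiable at \<open>0\<close>, it is first replaced by \<open>sqrt (norm e ^ 2 + \<eta>\<^sup>2)\<close>, whose derivative obeys
  the same inequality; at the end \<open>\<eta>\<close> tends to \<open>0\<close>. Differentiating \<open>norm e ^ 2\<close> and
  dividing by the norm keeps the exponent at \<open>\<integral> m\<close> and allows the inhomogeneity \<open>\<rho>\<close>.
\<close>

lemma gronwall_norm:
  fixes e e' :: "real \<Rightarrow> 'a::real_inner"
  assumes "a \<le> b"
    and der: "\<And>t. t \<in> {a..b} \<Longrightarrow> (e has_vector_derivative e' t) (at t within {a..b})"
    and bound: "\<And>t. t \<in> {a..b} \<Longrightarrow> norm (e' t) \<le> m t * norm (e t) + \<rho>"
    and m: "continuous_on {a..b} m" "\<And>t. t \<in> {a..b} \<Longrightarrow> 0 \<le> m t"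
    and "\<rho> \<ge> 0"
  shows "norm (e b) \<le> (norm (e a) + \<rho> * (b - a)) * exp (integral {a..b} m)"
proof -
  define \<Phi> where "\<Phi> s = integral {a..s} m" for s
  have d\<Phi>: "(\<Phi> has_real_derivative m t) (at t within {a..b})" if "t \<in> {a..b}" for t
    unfolding \<Phi>_def by (rule integral_has_real_derivative[OF m(1) that])
  have \<Phi>0: "\<Phi> t \<ge> 0" if "t \<in> {a..b}" for t
    unfolding \<Phi>_def by (rule integral_nonneg)
      (use that m in \<open>auto intro!: integrable_continuous_real continuous_on_subset[OF m(1)]\<close>)
  have main: "sqrt (norm (e b) ^ 2 + \<eta>\<^sup>2) * exp (- \<Phi> b) \<le> sqrt (norm (e a) ^ 2 + \<eta>\<^sup>2) + \<rho> * (b - a)"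
    if "\<eta> > 0" for \<eta>
  proof -
    define \<phi> where "\<phi> s = sqrt (e s \<bullet> e s + \<eta>\<^sup>2)" for s
    have pos: "e s \<bullet> e s + \<eta>\<^sup>2 > 0" for s
      using \<open>\<eta> > 0\<close> by (simp add: add_nonneg_pos)
    then have \<phi>pos: "\<phi> s > 0" for s by (simp add: \<phi>_def)
    have \<phi>ge: "norm (e s) \<le> \<phi> s" for s
      unfolding \<phi>_def by (rule real_le_rsqrt) (simp add: power2_norm_eq_inner)
    define h where "h s = \<phi> s * exp (- \<Phi> s) - \<rho> * s" for s
    define h' where "h' s = (e s \<bullet> e' s / \<phi> s - m s * \<phi> s) * exp (- \<Phi> s) - \<rho>" for s
    have dh: "(h has_real_derivative h' t) (at t within {a..b})" if t: "t \<in> {a..b}" for t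
    proof -
      note der[OF t, unfolded has_vector_derivative_def, derivative_intros]
      have D: "((\<lambda>s. e s \<bullet> e s + \<eta>\<^sup>2) has_derivative (*) (2 * (e t \<bullet> e' t))) (at t within {a..b})"
        by (auto intro!: derivative_eq_intros simp: inner_commute algebra_simps fun_eq_iff)
      have "(\<phi> has_real_derivative inverse (sqrt (e t \<bullet> e t + \<eta>\<^sup>2)) / 2 * (2 * (e t \<bullet> e' t))) (at t within {a..b})"
        unfolding \<phi>_def
        by (rule DERIV_chain2[where f = sqrt and g = "\<lambda>s. e s \<bullet> e s + \<eta>\<^sup>2" and x = t, OF DERIV_real_sqrt[OF pos[of t]]]) (use D in \<open>simp add: has_field_derivative_def\<close>)
      then have "(\<phi> has_real_derivative (e t \<bullet> e' t) / \<phi> t) (at t within {a..b})"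
        by (rule DERIV_cong) (simp add: \<phi>_def field_simps)
      note [derivative_intros] = this d\<Phi>[OF t]
      show ?thesis unfolding h_def h'_def
        by (auto intro!: derivative_eq_intros simp: algebra_simps)
    qed
    have neg: "h' t \<le> 0" if t: "t \<in> {a..b}" for t
    proof -
      have "e t \<bullet> e' t \<le> norm (e t) * norm (e' t)" by (rule norm_cauchy_schwarz)
      also have "\<dots> \<le> norm (e t) * (m t * norm (e t) + \<rho>)"
        by (intro mult_left_mono bound t) auto
      also have "\<dots> \<le> \<phi> t * (m t * \<phi> t + \<rho>)"
        using \<phi>ge[of t] m(2)[OF t] \<open>\<rho> \<ge> 0\<close> \<phi>pos[of t]
        by (intro mult_mono add_mono) auto
      finally have "e t \<bullet> e' t / \<phi> t \<le> m t * \<phi> t + \<rho>"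
        using \<phi>pos[of t] by (simp add: field_simps)
      then have "(e t \<bullet> e' t / \<phi> t - m t * \<phi> t) * exp (- \<Phi> t) \<le> \<rho> * exp (- \<Phi> t)"
        by (intro mult_right_mono) auto
      also have "\<dots> \<le> \<rho> * 1"
        using \<Phi>0[OF t] \<open>\<rho> \<ge> 0\<close> by (intro mult_left_mono) auto
      finally show ?thesis by (simp add: h'_def)
    qed
    have "\<exists>x\<in>{a..b}. h b - h a = (\<lambda>z. h' x * z) (b - a)"
      by (rule mvt_very_simple[OF \<open>a \<le> b\<close>, where f' = "\<lambda>x z. h' x * z"])
        (use dh in \<open>auto simp: has_field_derivative_def\<close>)
    then obtain x where x: "x \<in> {a..b}" "h b - h a = h' x * (b - a)" by auto
    have "h' x * (b - a) \<le> 0"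
      using neg[OF x(1)] \<open>a \<le> b\<close> by (intro mult_nonpos_nonneg) auto
    then have "h b \<le> h a" using x(2) by linarith
    moreover have "\<Phi> a = 0" by (simp add: \<Phi>_def)
    ultimately show ?thesis
      by (simp add: h_def \<phi>_def power2_norm_eq_inner algebra_simps)
  qed
  have "((\<lambda>\<eta>. sqrt (norm (e a) ^ 2 + \<eta>\<^sup>2) + \<rho> * (b - a) - sqrt (norm (e b) ^ 2 + \<eta>\<^sup>2) * exp (- \<Phi> b)) \<longlongrightarrow>
      sqrt (norm (e a) ^ 2 + 0\<^sup>2) + \<rho> * (b - a) - sqrt (norm (e b) ^ 2 + 0\<^sup>2) * exp (- \<Phi> b)) (at_right 0)"
    by (intro tendsto_intros)
  then have "0 \<le> sqrt (norm (e a) ^ 2 + 0\<^sup>2) + \<rho> * (b - a) - sqrt (norm (e b) ^ 2 + 0\<^sup>2) * exp (- \<Phi> b)"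
    by (rule tendsto_lowerbound)
      (auto simp: eventually_at_right_field intro!: exI[of _ 1] main)
  then have "norm (e b) * exp (- \<Phi> b) \<le> norm (e a) + \<rho> * (b - a)" by simp
  then have "norm (e b) * exp (- \<Phi> b) * exp (\<Phi> b) \<le> (norm (e a) + \<rho> * (b - a)) * exp (\<Phi> b)"
    by (intro mult_right_mono) auto
  then show ?thesis by (simp add: \<Phi>_def mult.assoc flip: exp_add)
qed

text \<open>
  By the mean value theorem in the direction \<open>v\<close>, the second difference is \<open>s\<close> times the
  difference of \<open>f' y v\<close> at two points that differ by \<open>s w\<close>. Differentiability of \<open>f' y v\<close> at the
  single point \<open>x\<close> turns this into \<open>s\<^sup>2 H w + o(s\<^sup>2)\<close>.
\<close>

lemma second_difference_quotient:
  fixes f :: "'a::real_normed_vector \<Rightarrow> real"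
  assumes "open S" "x \<in> S"
    and f: "\<And>y. y \<in> S \<Longrightarrow> (f has_derivative f' y) (at y)"
    and H: "((\<lambda>y. f' y v) has_derivative H) (at x)"
  shows "((\<lambda>s. (f (x + s *\<^sub>R v + s *\<^sub>R w) - f (x + s *\<^sub>R v) - f (x + s *\<^sub>R w) + f x) / s\<^sup>2) \<longlongrightarrow> H w) (at_right 0)"
proof (rule tendstoI)
  fix \<epsilon> :: real assume "\<epsilon> > 0"
  interpret H: bounded_linear H using H by (rule has_derivative_bounded_linear)
  define N where "N = 2 * norm v + norm w + 1"
  have "N > 0" by (simp add: N_def add_nonneg_pos)
  \<comment> \<open>\<open>s * N\<close> bounds all displacements below; two errors \<open>\<eta> * (s * N)\<close> must add up to less than \<open>\<epsilon> * s\<close>.\<close>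
  define \<eta> where "\<eta> = \<epsilon> / (3 * N)"
  have "\<eta> > 0" using \<open>\<epsilon> > 0\<close> \<open>N > 0\<close> by (simp add: \<eta>_def)
  obtain r1 where r1: "r1 > 0" "\<And>y. norm (y - x) < r1 \<Longrightarrow> norm (f' y v - f' x v - H (y - x)) \<le> \<eta> * norm (y - x)"
    using H \<open>\<eta> > 0\<close> unfolding has_derivative_at_alt by blast
  obtain r2 where r2: "r2 > 0" "ball x r2 \<subseteq> S"
    using assms(1,2) openE by blast
  define r where "r = min r1 r2 / N"
  have "r > 0" using r1 r2 \<open>N > 0\<close> by (simp add: r_def)
  have main: "\<bar>(f (x + s *\<^sub>R v + s *\<^sub>R w) - f (x + s *\<^sub>R v) - f (x + s *\<^sub>R w) + f x) / s\<^sup>2 - H w\<bar> < \<epsilon>"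
    if s: "0 < s" "s < r" for s
  proof -
    have sN: "s * N < min r1 r2" using s \<open>N > 0\<close> by (simp add: r_def field_simps)
    have small: "norm ((\<xi> * s) *\<^sub>R v + (\<theta> * s) *\<^sub>R w) \<le> s * N" if "\<xi> \<in> {0..1}" "\<theta> \<in> {0..1}" for \<xi> \<theta>
    proof -
      have "norm ((\<xi> * s) *\<^sub>R v + (\<theta> * s) *\<^sub>R w) \<le> norm ((\<xi> * s) *\<^sub>R v) + norm ((\<theta> * s) *\<^sub>R w)"
        by (rule norm_triangle_ineq)
      also have "\<dots> = s * (\<xi> * norm v + \<theta> * norm w)" using that s by (simp add: algebra_simps)
      also have "\<dots> \<le> s * (1 * norm v + 1 * norm w)"
        using that s by (intro mult_left_mono add_mono mult_right_mono) auto
      also have "\<dots> \<le> s * N" using s by (auto simp: N_def)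
      finally show ?thesis .
    qed
    have inS: "x + ((\<xi> * s) *\<^sub>R v + (\<theta> * s) *\<^sub>R w) \<in> S" if "\<xi> \<in> {0..1}" "\<theta> \<in> {0..1}" for \<xi> \<theta>
    proof (rule subsetD[OF r2(2)])
      have "dist (x + ((\<xi> * s) *\<^sub>R v + (\<theta> * s) *\<^sub>R w)) x < r2"
        using small[OF that] sN by (simp add: dist_norm)
      then show "x + ((\<xi> * s) *\<^sub>R v + (\<theta> * s) *\<^sub>R w) \<in> ball x r2"
        by (simp add: dist_commute)
    qed
    define \<phi> where "\<phi> \<tau> = f (x + ((\<tau> * s) *\<^sub>R v + (1 * s) *\<^sub>R w)) - f (x + ((\<tau> * s) *\<^sub>R v + (0 * s) *\<^sub>R w))" for \<tau>
    define \<phi>' where "\<phi>' \<tau> = s * (f' (x + ((\<tau> * s) *\<^sub>R v + (1 * s) *\<^sub>R w)) v - f' (x + ((\<tau> * s) *\<^sub>R v + (0 * s) *\<^sub>R w)) v)" for \<tau>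
    have "(\<phi> has_derivative (\<lambda>z. z * \<phi>' \<tau>)) (at \<tau> within {0..1})" if \<tau>: "0 \<le> \<tau>" "\<tau> \<le> 1" for \<tau>
    proof -
      have d: "((\<lambda>\<tau>. f (x + ((\<tau> * s) *\<^sub>R v + (\<theta> * s) *\<^sub>R w))) has_derivative
          (\<lambda>z. z * (s * f' (x + ((\<tau> * s) *\<^sub>R v + (\<theta> * s) *\<^sub>R w)) v))) (at \<tau> within {0..1})"
        if "\<theta> \<in> {0..1}" for \<theta>
      proof -
        have y: "x + ((\<tau> * s) *\<^sub>R v + (\<theta> * s) *\<^sub>R w) \<in> S" using \<tau> that by (intro inS) auto
        then have bl: "bounded_linear (f' (x + ((\<tau> * s) *\<^sub>R v + (\<theta> * s) *\<^sub>R w)))"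
          using f has_derivative_bounded_linear by blast
        have "((\<lambda>\<tau>. x + ((\<tau> * s) *\<^sub>R v + (\<theta> * s) *\<^sub>R w)) has_derivative (\<lambda>z. (z * s) *\<^sub>R v)) (at \<tau> within {0..1})"
          by (auto intro!: derivative_eq_intros)
        from has_derivative_compose[OF this f[OF y]] show ?thesis
          by (simp add: linear_simps[OF bl] mult.assoc)
      qed
      show ?thesis unfolding \<phi>_def \<phi>'_def
        by (rule has_derivative_eq_rhs[OF has_derivative_diff[OF d d]]) (auto simp: algebra_simps)
    qed
    then obtain \<xi> where \<xi>: "\<xi> \<in> {0..1}" "\<phi> 1 - \<phi> 0 = \<phi>' \<xi>"
      using mvt_very_simple[of 0 1 \<phi> "\<lambda>\<tau> z. z * \<phi>' \<tau>"] by auto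
    define y1 where "y1 = (\<xi> * s) *\<^sub>R v + (1 * s) *\<^sub>R w"
    define y0 where "y0 = (\<xi> * s) *\<^sub>R v + (0 * s) *\<^sub>R w"
    have n1: "norm y1 \<le> s * N" "norm y0 \<le> s * N"
      using \<xi>(1) unfolding y1_def y0_def by (intro small; simp)+
    have b1: "\<bar>f' (x + y1) v - f' x v - H y1\<bar> \<le> \<eta> * (s * N)"
    proof -
      have "\<bar>f' (x + y1) v - f' x v - H y1\<bar> \<le> \<eta> * norm y1"
        using r1(2)[of "x + y1"] n1(1) sN by simp
      also have "\<dots> \<le> \<eta> * (s * N)" using n1(1) \<open>\<eta> > 0\<close> by simp
      finally show ?thesis .
    qed
    have b0: "\<bar>f' (x + y0) v - f' x v - H y0\<bar> \<le> \<eta> * (s * N)"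
    proof -
      have "\<bar>f' (x + y0) v - f' x v - H y0\<bar> \<le> \<eta> * norm y0"
        using r1(2)[of "x + y0"] n1(2) sN by simp
      also have "\<dots> \<le> \<eta> * (s * N)" using n1(2) \<open>\<eta> > 0\<close> by simp
      finally show ?thesis .
    qed
    have "H y1 - H y0 = s * H w"
      by (simp add: y1_def y0_def H.add H.scaleR)
    then have b: "\<bar>f' (x + y1) v - f' (x + y0) v - s * H w\<bar> \<le> 2 * \<eta> * (s * N)"
      using b1 b0 by linarith
    have \<Delta>: "f (x + s *\<^sub>R v + s *\<^sub>R w) - f (x + s *\<^sub>R v) - f (x + s *\<^sub>R w) + f x = s * (f' (x + y1) v - f' (x + y0) v)"
      using \<xi>(2) by (simp add: \<phi>_def \<phi>'_def y1_def y0_def add.assoc)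
    have "\<bar>(f (x + s *\<^sub>R v + s *\<^sub>R w) - f (x + s *\<^sub>R v) - f (x + s *\<^sub>R w) + f x) / s\<^sup>2 - H w\<bar>
        = \<bar>f' (x + y1) v - f' (x + y0) v - s * H w\<bar> / s"
    proof -
      have "s * (f' (x + y1) v - f' (x + y0) v) / s\<^sup>2 - H w = (f' (x + y1) v - f' (x + y0) v - s * H w) / s"
        using s by (simp add: power2_eq_square field_simps)
      then show ?thesis unfolding \<Delta> using s by simp
    qed
    also have "\<dots> \<le> 2 * \<eta> * (s * N) / s" using s by (intro divide_right_mono b) auto
    also have "\<dots> = 2 * \<epsilon> / 3" using s \<open>N > 0\<close> by (simp add: \<eta>_def)
    also have "\<dots> < \<epsilon>" using \<open>\<epsilon> > 0\<close> by simp
    finally show ?thesis .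
  qed
  then show "\<forall>\<^sub>F s in at_right 0. dist ((f (x + s *\<^sub>R v + s *\<^sub>R w) - f (x + s *\<^sub>R v) - f (x + s *\<^sub>R w) + f x) / s\<^sup>2) (H w) < \<epsilon>"
    unfolding eventually_at_right_field dist_real_def using \<open>r > 0\<close> by blast
qed

text \<open>
  Young's theorem without continuity of second derivatives: the second difference quotient is
  symmetric in \<open>v\<close> and \<open>w\<close>. The pressure has to be treated at this generality, because nothing is
  assumed about it beyond the existence of a gradient, and that gradient is seen to be
  differentiable only through the momentum equation.
\<close>

lemma second_derivative_symmetric:
  fixes f :: "'a::real_normed_vector \<Rightarrow> real"
  assumes "open S" "x \<in> S"
    and f: "\<And>y. y \<in> S \<Longrightarrow> (f has_derivative f' y) (at y)"
    and Hv: "((\<lambda>y. f' y v) has_derivative Hv) (at x)"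
    and Hw: "((\<lambda>y. f' y w) has_derivative Hw) (at x)"
  shows "Hv w = Hw v"
proof (rule tendsto_unique)
  show "((\<lambda>s. (f (x + s *\<^sub>R v + s *\<^sub>R w) - f (x + s *\<^sub>R v) - f (x + s *\<^sub>R w) + f x) / s\<^sup>2) \<longlongrightarrow> Hv w) (at_right 0)"
    by (rule second_difference_quotient[OF assms(1-4)])
  show "((\<lambda>s. (f (x + s *\<^sub>R v + s *\<^sub>R w) - f (x + s *\<^sub>R v) - f (x + s *\<^sub>R w) + f x) / s\<^sup>2) \<longlongrightarrow> Hw v) (at_right 0)"
    using second_difference_quotient[OF assms(1-3) Hw, of v]
    by (simp add: algebra_simps)
qed simp

section \<open>Derivatives up to the boundary\<close>

lemma smooth_on_open_has_derivative:
  assumes "smooth_on_open U g" "x \<in> U"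
  shows "(g has_derivative frechet_derivative g (at x)) (at x)"
proof -
  have "g differentiable_on U" "open U"
    using assms(1) Ck_on.simps(2)[of 0 U g] unfolding smooth_on_open_def by blast+
  then have "g differentiable (at x)"
    using assms(2) by (simp add: differentiable_on_eq_differentiable_at)
  then show ?thesis by (simp add: frechet_derivative_works)
qed

lemma smooth_on_open_frechet_derivative:
  assumes "smooth_on_open U g"
  shows "smooth_on_open U (\<lambda>x. frechet_derivative g (at x) v)"
  using assms Ck_on.simps(2) unfolding smooth_on_open_def by blast

lemma smooth_on_open_continuous_on:
  assumes "smooth_on_open U g"
  shows "continuous_on U g"
  using assms Ck_on.simps(1) unfolding smooth_on_open_def by blast

lemma eq_on_closure:
  fixes f g :: "'a::metric_space \<Rightarrow> 'b::t2_space"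
  assumes "continuous_on S f" "continuous_on S g" "D \<subseteq> S" "\<And>x. x \<in> D \<Longrightarrow> f x = g x"
    and "x \<in> S" "x \<in> closure D"
  shows "f x = g x"
proof -
  obtain X where X: "\<And>n. X n \<in> D" "X \<longlonglongrightarrow> x"
    using \<open>x \<in> closure D\<close> by (auto simp: closure_sequential)
  have "(\<lambda>n. f (X n)) \<longlonglongrightarrow> f x" "(\<lambda>n. g (X n)) \<longlonglongrightarrow> g x"
    using X subsetD[OF assms(3)] assms(5) by (auto intro!: continuous_on_tendsto_compose[OF assms(1)] continuous_on_tendsto_compose[OF assms(2)])
  moreover have "(\<lambda>n. f (X n)) = (\<lambda>n. g (X n))" using X assms(4) by auto
  ultimately show ?thesis using LIMSEQ_unique by metis
qed

lemma le_on_closure: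
  fixes f :: "'a::metric_space \<Rightarrow> real"
  assumes "continuous_on S f" "D \<subseteq> S" "\<And>x. x \<in> D \<Longrightarrow> f x \<le> K"
    and "x \<in> S" "x \<in> closure D"
  shows "f x \<le> K"
proof -
  obtain X where X: "\<And>n. X n \<in> D" "X \<longlonglongrightarrow> x"
    using \<open>x \<in> closure D\<close> by (auto simp: closure_sequential)
  have "(\<lambda>n. f (X n)) \<longlonglongrightarrow> f x"
    using X subsetD[OF assms(2)] assms(4) by (auto intro!: continuous_on_tendsto_compose[OF assms(1)])
  then show ?thesis by (rule LIMSEQ_le_const2) (use X assms(3) in auto)
qed

text \<open>
  On the interior of \<open>A\<close> both functions coincide with the function that they extend; the interior is
  dense in \<open>A\<close> and derivatives of smooth functions are continuous.
\<close>

lemma derivatives_of_extensions_agree: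
  assumes A: "A \<subseteq> closure (interior A)"
    and g: "smooth_on_open U g" and h: "smooth_on_open V h"
    and eq: "\<And>y. y \<in> U \<inter> V \<inter> A \<Longrightarrow> g y = h y"
    and z: "z \<in> U \<inter> V \<inter> A"
  shows "frechet_derivative g (at z) v = frechet_derivative h (at z) v"
proof (rule eq_on_closure[where x = z and S = "U \<inter> V" and D = "U \<inter> V \<inter> interior A"
      and f = "\<lambda>z. frechet_derivative g (at z) v" and g = "\<lambda>z. frechet_derivative h (at z) v"])
  have [simp]: "open U" "open V" using g h by (auto simp: smooth_on_open_def)
  show "continuous_on (U \<inter> V) (\<lambda>z. frechet_derivative g (at z) v)"
    "continuous_on (U \<inter> V) (\<lambda>z. frechet_derivative h (at z) v)"
    using smooth_on_open_continuous_on[OF smooth_on_open_frechet_derivative[OF g]]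
      smooth_on_open_continuous_on[OF smooth_on_open_frechet_derivative[OF h]]
    by (auto intro: continuous_on_subset)
  show "frechet_derivative g (at y) v = frechet_derivative h (at y) v" if "y \<in> (U \<inter> V) \<inter> interior A" for y
  proof -
    have "(g has_derivative frechet_derivative h (at y)) (at y)"
    proof (rule has_derivative_transform_within_open)
      show "(h has_derivative frechet_derivative h (at y)) (at y)"
        by (rule smooth_on_open_has_derivative[OF h]) (use that in auto)
      show "open (U \<inter> V \<inter> interior A)" by (simp add: open_Int)
      show "h w = g w" if "w \<in> U \<inter> V \<inter> interior A" for w
        using eq[of w] that interior_subset by fastforce
    qed (use that in auto)
    then show ?thesis by (simp flip: frechet_derivative_at)
  qed
  show "z \<in> closure ((U \<inter> V) \<inter> interior A)"
    using open_Int_closure_subset[OF open_Int[OF \<open>open U\<close> \<open>open V\<close>], of "interior A"] z A by blast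
qed (use z in auto)

text \<open>
  The directional derivative at points of \<open>A\<close>, boundary included, of a function that is smooth on
  \<open>A\<close>. The choice of the local extension is immaterial by \<open>derivatives_of_extensions_agree\<close>.
  The direction precedes the point, so that \<open>ext_deriv A f v\<close> is again a function on \<open>A\<close> and can be
  differentiated.
\<close>

definition ext_deriv :: "'a::euclidean_space set \<Rightarrow> ('a \<Rightarrow> 'b::euclidean_space) \<Rightarrow> 'a \<Rightarrow> 'a \<Rightarrow> 'b" where
  "ext_deriv A f v z =
     frechet_derivative (SOME g. \<exists>U. z \<in> U \<and> smooth_on_open U g \<and> (\<forall>y\<in>U \<inter> A. g y = f y)) (at z) v"

lemma ext_deriv_eq:
  assumes A: "A \<subseteq> closure (interior A)"
    and g: "smooth_on_open U g" "\<And>y. y \<in> U \<inter> A \<Longrightarrow> g y = f y" and z: "z \<in> U \<inter> A"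
  shows "ext_deriv A f v z = frechet_derivative g (at z) v"
proof -
  define h where "h = (SOME g. \<exists>U. z \<in> U \<and> smooth_on_open U g \<and> (\<forall>y\<in>U \<inter> A. g y = f y))"
  have "\<exists>V. z \<in> V \<and> smooth_on_open V h \<and> (\<forall>y\<in>V \<inter> A. h y = f y)"
    unfolding h_def by (rule someI[of _ g]) (use g z in auto)
  then obtain V where V: "z \<in> V" "smooth_on_open V h" "\<forall>y\<in>V \<inter> A. h y = f y" by blast
  have "frechet_derivative h (at z) v = frechet_derivative g (at z) v"
    by (rule derivatives_of_extensions_agree[OF A V(2) g(1)]) (use V g z in auto)
  then show ?thesis by (simp add: ext_deriv_def h_def)
qed

lemma smooth_on_local_extension:
  assumes "A \<subseteq> closure (interior A)" "smooth_on A f" "z \<in> A"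
  obtains U g where "z \<in> U" "open U" "smooth_on_open U g" "\<And>y. y \<in> U \<inter> A \<Longrightarrow> g y = f y"
    "\<And>y v. y \<in> U \<inter> A \<Longrightarrow> ext_deriv A f v y = frechet_derivative g (at y) v"
    "\<And>y. y \<in> U \<inter> A \<Longrightarrow> (g has_derivative (\<lambda>v. ext_deriv A f v y)) (at y)"
proof -
  obtain U g where U: "z \<in> U" "smooth_on_open U g" "\<forall>y\<in>U \<inter> A. g y = f y"
    using assms(2,3) unfolding smooth_on_def by blast
  have e: "ext_deriv A f v y = frechet_derivative g (at y) v" if "y \<in> U \<inter> A" for y v
    by (rule ext_deriv_eq[OF assms(1) U(2)]) (use U that in auto)
  moreover have "(g has_derivative (\<lambda>v. ext_deriv A f v y)) (at y)" if "y \<in> U \<inter> A" for y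
    using smooth_on_open_has_derivative[OF U(2)] that by (simp add: e)
  moreover have "open U" using U(2) by (simp add: smooth_on_open_def)
  ultimately show ?thesis using that U by blast
qed

lemma smooth_on_ext_deriv:
  assumes "A \<subseteq> closure (interior A)" "smooth_on A f"
  shows "smooth_on A (ext_deriv A f v)"
  unfolding smooth_on_def
proof
  fix z assume "z \<in> A"
  from smooth_on_local_extension[OF assms this] obtain U g where
    "z \<in> U" "smooth_on_open U g" "\<And>y v. y \<in> U \<inter> A \<Longrightarrow> ext_deriv A f v y = frechet_derivative g (at y) v"
    by metis
  then show "\<exists>U g. z \<in> U \<and> smooth_on_open U g \<and> (\<forall>y\<in>U \<inter> A. g y = ext_deriv A f v y)"
    using smooth_on_open_frechet_derivative by (metis (no_types, lifting))
qed

lemma smooth_on_imp_continuous_on: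
  assumes "smooth_on A f"
  shows "continuous_on A f"
  unfolding continuous_on_eq_continuous_within
proof
  fix z assume "z \<in> A"
  then obtain U g where U: "z \<in> U" "smooth_on_open U g" "\<forall>y\<in>U \<inter> A. g y = f y"
    using assms unfolding smooth_on_def by blast
  then have "continuous (at z) g"
    by (meson smooth_on_open_def smooth_on_open_continuous_on continuous_on_eq_continuous_at)
  then have "continuous (at z within A) g" by (rule continuous_at_imp_continuous_at_within)
  moreover have "\<forall>\<^sub>F y in at z within A. g y = f y"
    using U by (auto simp: eventually_at_topological smooth_on_open_def)
  ultimately show "continuous (at z within A) f"
    using \<open>z \<in> A\<close> U by (auto simp: continuous_within intro: Lim_transform_eventually)
qed

lemma ext_deriv_bounded_linear:
  assumes "A \<subseteq> closure (interior A)" "smooth_on A f" "z \<in> A"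
  shows "bounded_linear (\<lambda>v. ext_deriv A f v z)"
  using smooth_on_local_extension[OF assms] has_derivative_bounded_linear assms(3)
  by (metis (no_types, lifting) IntI)

text \<open>
  Only a map into \<open>A\<close> can be composed with \<open>f\<close>, but locally \<open>f\<close> may be replaced by a smooth
  extension, for which this is the chain rule on an open set.
\<close>

lemma ext_deriv_chain:
  assumes A: "A \<subseteq> closure (interior A)" "smooth_on A f"
    and \<gamma>: "(\<gamma> has_derivative \<gamma>') (at x within S)" "\<And>y. y \<in> S \<Longrightarrow> \<gamma> y \<in> A" "x \<in> S"
  shows "((\<lambda>y. f (\<gamma> y)) has_derivative (\<lambda>v. ext_deriv A f (\<gamma>' v) (\<gamma> x))) (at x within S)"
proof -
  have "\<gamma> x \<in> A" using \<gamma> by auto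
  from smooth_on_local_extension[OF A this] obtain U g where U: "\<gamma> x \<in> U" "open U"
    "\<And>y. y \<in> U \<inter> A \<Longrightarrow> g y = f y"
    "\<And>y. y \<in> U \<inter> A \<Longrightarrow> (g has_derivative (\<lambda>v. ext_deriv A f v y)) (at y)"
    by metis
  have "((\<lambda>y. g (\<gamma> y)) has_derivative (\<lambda>v. ext_deriv A f (\<gamma>' v) (\<gamma> x))) (at x within S)"
    using has_derivative_compose[OF \<gamma>(1) U(4)] U(1) \<open>\<gamma> x \<in> A\<close> by auto
  moreover have "\<forall>\<^sub>F y in at x within S. g (\<gamma> y) = f (\<gamma> y)"
  proof -
    have "(\<gamma> \<longlongrightarrow> \<gamma> x) (at x within S)"
      using has_derivative_continuous[OF \<gamma>(1)] by (simp add: continuous_within)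
    then have "\<forall>\<^sub>F y in at x within S. \<gamma> y \<in> U" by (rule topological_tendstoD) (use U(1,2) in auto) 
    moreover have "\<forall>\<^sub>F y in at x within S. y \<in> S"
      by (auto simp: eventually_at_filter)
    ultimately show ?thesis
      by eventually_elim (use U(3) \<gamma>(2) in auto)
  qed
  ultimately show ?thesis
    by (rule has_derivative_transform_eventually) (use U(1,3) \<gamma>(2,3) in auto)
qed

lemma ext_deriv_interior:
  assumes "A \<subseteq> closure (interior A)" "smooth_on A f" "z \<in> interior A"
  shows "(f has_derivative (\<lambda>v. ext_deriv A f v z)) (at z)"
proof -
  have "((\<lambda>y. f y) has_derivative (\<lambda>v. ext_deriv A f v z)) (at z within interior A)"
    by (rule ext_deriv_chain[OF assms(1,2)]) (use assms(3) interior_subset in auto)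
  then show ?thesis using assms(3) at_within_open[of z "interior A"] by auto
qed

lemma ext_deriv_commute:
  assumes A: "A \<subseteq> closure (interior A)" "smooth_on A f" "z \<in> A"
  shows "ext_deriv A (ext_deriv A f v) w z = ext_deriv A (ext_deriv A f w) v z"
proof (rule eq_on_closure[where x = z and S = A and D = "interior A"])
  note s = smooth_on_ext_deriv[OF A(1)]
  show "continuous_on A (ext_deriv A (ext_deriv A f v) w)"
    "continuous_on A (ext_deriv A (ext_deriv A f w) v)"
    by (intro smooth_on_imp_continuous_on s A(2))+
  show "z \<in> closure (interior A)" using A by auto
  show "ext_deriv A (ext_deriv A f v) w y = ext_deriv A (ext_deriv A f w) v y" if y: "y \<in> interior A" for y
  proof (rule euclidean_eqI)
    fix b :: 'b assume "b \<in> Basis"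
    show "ext_deriv A (ext_deriv A f v) w y \<bullet> b = ext_deriv A (ext_deriv A f w) v y \<bullet> b"
    proof (rule second_derivative_symmetric[OF open_interior y, where f' = "\<lambda>y v. ext_deriv A f v y \<bullet> b" and f = "\<lambda>y. f y \<bullet> b"
          and v = v and w = w and Hv = "\<lambda>w. ext_deriv A (ext_deriv A f v) w y \<bullet> b"
          and Hw = "\<lambda>v. ext_deriv A (ext_deriv A f w) v y \<bullet> b"])
      show "((\<lambda>y. f y \<bullet> b) has_derivative (\<lambda>v. ext_deriv A f v y \<bullet> b)) (at y)" if "y \<in> interior A" for y
        using ext_deriv_interior[OF A(1,2) that] by (rule has_derivative_inner_left)
      show "((\<lambda>y. ext_deriv A f v y \<bullet> b) has_derivative (\<lambda>w. ext_deriv A (ext_deriv A f v) w y \<bullet> b)) (at y)"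
        using ext_deriv_interior[OF A(1) s[OF A(2)] y] by (rule has_derivative_inner_left)
      show "((\<lambda>y. ext_deriv A f w y \<bullet> b) has_derivative (\<lambda>v. ext_deriv A (ext_deriv A f w) v y \<bullet> b)) (at y)"
        using ext_deriv_interior[OF A(1) s[OF A(2)] y] by (rule has_derivative_inner_left)
    qed
  qed
qed (use A interior_subset in auto)

text \<open>
  The set \<open>A\<close> need not be locally convex near a boundary point, so the mean value inequality is
  applied to a smooth extension on a full ball around \<open>z0\<close>, on which its derivative is nearly
  constant.
\<close>

lemma ext_deriv_locally_uniform:
  assumes A: "A \<subseteq> closure (interior A)" "smooth_on A f" "z0 \<in> A" and "\<epsilon> > 0"
  shows "\<exists>r>0. \<forall>z\<in>A \<inter> ball z0 r. \<forall>y\<in>A \<inter> ball z0 r.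
    norm (f y - f z - ext_deriv A f (y - z) z) \<le> \<epsilon> * norm (y - z)"
proof -
  from smooth_on_local_extension[OF A] obtain U g where U: "z0 \<in> U" "open U"
    "smooth_on_open U g" "\<And>y. y \<in> U \<inter> A \<Longrightarrow> g y = f y"
    "\<And>y v. y \<in> U \<inter> A \<Longrightarrow> ext_deriv A f v y = frechet_derivative g (at y) v"
    by metis
  define D where "D y = frechet_derivative g (at y)" for y
  define N :: real where "N = DIM('a)"
  have "N > 0" by (simp add: N_def)
  have bl: "bounded_linear (D y)" if "y \<in> U" for y
    unfolding D_def by (rule has_derivative_bounded_linear[OF smooth_on_open_has_derivative[OF U(3) that]])
  have cont: "continuous (at z0) (\<lambda>y. D y b)" for b
    using smooth_on_open_continuous_on[OF smooth_on_open_frechet_derivative[OF U(3)]] U(1,2)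
    unfolding D_def by (metis continuous_on_eq_continuous_at)
  have ev: "\<forall>\<^sub>F y in nhds z0. \<forall>b\<in>Basis. norm (D y b - D z0 b) < \<epsilon> / (2 * N)"
  proof (rule eventually_ball_finite, simp, rule ballI)
    fix b :: 'a
    have "((\<lambda>y. D y b) \<longlongrightarrow> D z0 b) (nhds z0)"
      using cont[of b] tendsto_at_iff_tendsto_nhds[of "\<lambda>y. D y b" z0] by (simp add: continuous_at)
    then show "\<forall>\<^sub>F y in nhds z0. norm (D y b - D z0 b) < \<epsilon> / (2 * N)"
      unfolding tendsto_iff dist_norm using \<open>\<epsilon> > 0\<close> \<open>N > 0\<close> by auto
  qed
  have "\<forall>\<^sub>F y in nhds z0. y \<in> U \<and> (\<forall>b\<in>Basis. norm (D y b - D z0 b) < \<epsilon> / (2 * N))"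
    using ev U(1,2) by (auto intro: eventually_conj eventually_nhds_in_open)
  then obtain r where r: "r > 0"
    "\<And>y. dist y z0 < r \<Longrightarrow> y \<in> U \<and> (\<forall>b\<in>Basis. norm (D y b - D z0 b) < \<epsilon> / (2 * N))"
    unfolding eventually_nhds_metric by blast
  have on0: "onorm (D y - D z0) \<le> \<epsilon> / 2" if "y \<in> ball z0 r" for y
  proof -
    have y: "y \<in> U" "\<And>b. b \<in> Basis \<Longrightarrow> norm (D y b - D z0 b) \<le> \<epsilon> / (2 * N)"
      using r(2)[of y] that by (auto simp: dist_commute less_imp_le)
    have "linear (D y - D z0)"
      unfolding fun_diff_def using bl[OF y(1)] bl[OF U(1)]
      by (intro bounded_linear.linear bounded_linear_sub)
    then have "onorm (D y - D z0) \<le> (\<Sum>b\<in>Basis. norm ((D y - D z0) b))"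
      by (intro onorm_componentwise) (simp add: linear_conv_bounded_linear)
    also have "\<dots> \<le> of_nat (card (Basis::'a set)) * (\<epsilon> / (2 * N))"
      by (rule sum_bounded_above) (use y(2) in auto)
    also have "\<dots> = \<epsilon> / 2" using \<open>N > 0\<close> by (simp add: N_def)
    finally show ?thesis .
  qed
  have "norm (f y - f z - ext_deriv A f (y - z) z) \<le> \<epsilon> * norm (y - z)"
    if z: "z \<in> A \<inter> ball z0 r" and y: "y \<in> A \<inter> ball z0 r" for z y
  proof -
    have "norm (g y - g z - D z (y - z)) \<le> norm (y - z) * \<epsilon>"
    proof (rule differentiable_bound_linearization)
      show "z + t *\<^sub>R (y - z) \<in> ball z0 r" if "t \<in> {0..1}" for t
      proof -
        have "(1 - t) *\<^sub>R z + t *\<^sub>R y \<in> ball z0 r"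
          by (rule convexD[OF convex_ball]) (use that y z in auto)
        then show ?thesis by (simp add: algebra_simps)
      qed
      show "(g has_derivative D w) (at w within ball z0 r)" if "w \<in> ball z0 r" for w
        unfolding D_def using smooth_on_open_has_derivative[OF U(3), of w] r(2)[of w] that
        by (auto simp: dist_commute intro: has_derivative_at_withinI)
      show "onorm (D w - D z) \<le> \<epsilon>" if w: "w \<in> ball z0 r" for w
      proof -
        have wz: "w \<in> U" "z \<in> U" using r(2)[of w] r(2)[of z] w z by (auto simp: dist_commute)
        have b: "bounded_linear (\<lambda>v. D w v - D z0 v)" "bounded_linear (\<lambda>v. D z v - D z0 v)"
          using bl wz U(1) by (auto intro!: bounded_linear_sub)
        have "D w - D z = (\<lambda>v. (D w v - D z0 v) + - (D z v - D z0 v))" by (auto simp: fun_eq_iff)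
        then have "onorm (D w - D z) \<le> onorm (\<lambda>v. D w v - D z0 v) + onorm (\<lambda>v. - (D z v - D z0 v))"
          using onorm_triangle[OF b(1) bounded_linear_minus[OF b(2)]] by simp
        also have "\<dots> = onorm (D w - D z0) + onorm (D z - D z0)"
          by (subst onorm_neg) (simp add: fun_diff_def)
        also have "\<dots> \<le> \<epsilon>" using on0[OF w] on0[of z] z by auto
        finally show ?thesis .
      qed
      show "z \<in> ball z0 r" using z by auto
    qed
    moreover have "y \<in> U" "z \<in> U" using r(2)[of y] r(2)[of z] y z by (auto simp: dist_commute)
    ultimately show ?thesis using y z U(4,5) by (simp add: D_def mult.commute)
  qed
  then show ?thesis using r(1) by blast
qed

text \<open>
  A Lebesgue number makes the radius in \<open>ext_deriv_locally_uniform\<close> independent of the point.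
\<close>

lemma ext_deriv_uniform_on_compact:
  assumes A: "A \<subseteq> closure (interior A)" "smooth_on A f" and K: "compact K" "K \<subseteq> A" and "\<epsilon> > 0"
  shows "\<exists>r>0. \<forall>z\<in>K. \<forall>y\<in>A \<inter> ball z r. norm (f y - f z - ext_deriv A f (y - z) z) \<le> \<epsilon> * norm (y - z)"
proof -
  define good where "good B \<longleftrightarrow> (\<forall>z\<in>A \<inter> B. \<forall>y\<in>A \<inter> B.
    norm (f y - f z - ext_deriv A f (y - z) z) \<le> \<epsilon> * norm (y - z))" for B
  have "K \<subseteq> \<Union>{B. open B \<and> good B}"
  proof
    fix z0 assume "z0 \<in> K"
    then have "\<exists>r>0. good (ball z0 r)"
      using ext_deriv_locally_uniform[OF A, of z0 \<epsilon>] K(2) \<open>\<epsilon> > 0\<close> unfolding good_def by auto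
    then obtain r where r: "r > 0" "good (ball z0 r)" by blast
    show "z0 \<in> \<Union>{B. open B \<and> good B}"
      by (rule UnionI[of "ball z0 r"]) (use r in auto)
  qed
  from Heine_Borel_lemma[OF K(1) this] obtain r where
    r: "r > 0" "\<forall>z\<in>K. \<exists>B\<in>{B. open B \<and> good B}. ball z r \<subseteq> B"
    by (metis (lifting) mem_Collect_eq)
  show ?thesis
  proof (intro exI[of _ r] conjI ballI r(1))
    fix z y assume z: "z \<in> K" and y: "y \<in> A \<inter> ball z r"
    obtain B where B: "good B" "ball z r \<subseteq> B" using r(2) z by auto
    moreover have "z \<in> ball z r" using r(1) by simp
    ultimately show "norm (f y - f z - ext_deriv A f (y - z) z) \<le> \<epsilon> * norm (y - z)"
      using z y K(2) unfolding good_def by (meson IntD1 IntD2 IntI subsetD)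
  qed
qed

section \<open>Transport of absolute vorticity\<close>

lemma bounded_linear_cross_right: "bounded_linear (cross3 a)"
  using bilinear_cross by (simp add: bilinear_def linear_conv_bounded_linear)

locale rotating_euler_flow =
  fixes \<Omega> T :: real and R :: "(real^3) set"
    and u :: "real \<Rightarrow> real^3 \<Rightarrow> real^3" and \<pi> :: "real \<Rightarrow> real^3 \<Rightarrow> real"
  assumes T_pos: "T > 0" and open_R: "open R"
    and solution: "rotating_euler_solution \<Omega> T R u \<pi>"
begin

abbreviation cyl :: "(real \<times> (real^3)) set" where
  "cyl \<equiv> {0..T} \<times> closure R"

abbreviation vel :: "real \<times> (real^3) \<Rightarrow> real^3" where
  "vel \<equiv> \<lambda>(t, x). u t x"

definition Dt :: "(real \<times> (real^3) \<Rightarrow> real^3) \<Rightarrow> real \<times> (real^3) \<Rightarrow> real^3" where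
  "Dt f = ext_deriv cyl f (1, 0)"

definition Dx :: "3 \<Rightarrow> (real \<times> (real^3) \<Rightarrow> real^3) \<Rightarrow> real \<times> (real^3) \<Rightarrow> real^3" where
  "Dx j f = ext_deriv cyl f (0, axis j 1)"

definition material :: "(real \<times> (real^3) \<Rightarrow> real^3) \<Rightarrow> real \<times> (real^3) \<Rightarrow> real^3" where
  "material f z = Dt f z + (\<Sum>k\<in>UNIV. vel z $ k *\<^sub>R Dx k f z)"

definition vgrad :: "real \<times> (real^3) \<Rightarrow> real^3^3" where
  "vgrad z = (\<chi> i j. Dx j vel z $ i)"

text \<open>
  \<open>\<Sum>\<^sub>j e\<^sub>j \<times> c\<^sub>j\<close> is the curl of a vector field whose partial derivatives are the \<open>c\<^sub>j\<close>. It is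
  applied to the derivatives of the velocity and to their material derivatives, and its linearity in
  \<open>c\<close> is what allows it to be differentiated.
\<close>

definition curl_of_columns :: "(3 \<Rightarrow> real^3) \<Rightarrow> real^3" where
  "curl_of_columns c = (\<Sum>j\<in>UNIV. cross3 (axis j 1) (c j))"

definition vort :: "real \<times> (real^3) \<Rightarrow> real^3" where
  "vort z = curl_of_columns (\<lambda>j. Dx j vel z)"

lemma curl_of_columns_eq:
  "curl_of_columns c = vector [c 2 $ 3 - c 3 $ 2, c 3 $ 1 - c 1 $ 3, c 1 $ 2 - c 2 $ 1]"
  by (simp add: curl_of_columns_def sum_3 cross3_def axis_def vec_eq_iff forall_3)

lemma cyl_eq_closure: "cyl = closure ({0..T} \<times> R)"
  by (simp add: closure_Times)

text \<open>
  This is where \<open>T > 0\<close> and the openness of \<open>R\<close> enter: \<open>{0<..<T} \<times> R\<close> is open and dense in the cylinder.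
\<close>

lemma cyl_subset_closure_interior: "cyl \<subseteq> closure (interior cyl)"
proof -
  have "{0<..<T} \<times> R \<subseteq> interior cyl"
    by (rule interior_maximal) (use closure_subset[of R] open_R in \<open>auto intro!: open_Times\<close>)
  moreover have "cyl = closure ({0<..<T} \<times> R)"
    using T_pos by (simp add: closure_Times)
  ultimately show ?thesis using closure_mono by metis
qed

lemma vel_smooth: "smooth_on cyl vel"
  using solution by (simp add: rotating_euler_solution_def)

lemma Dt_smooth: "smooth_on cyl f \<Longrightarrow> smooth_on cyl (Dt f)"
  and Dx_smooth: "smooth_on cyl f \<Longrightarrow> smooth_on cyl (Dx j f)"
  unfolding Dt_def Dx_def by (simp_all add: smooth_on_ext_deriv[OF cyl_subset_closure_interior])

lemma ext_deriv_eq_partials: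
  assumes "smooth_on cyl f" "z \<in> cyl"
  shows "ext_deriv cyl f (s, v) z = s *\<^sub>R Dt f z + (\<Sum>j\<in>UNIV. v $ j *\<^sub>R Dx j f z)"
proof -
  interpret L: bounded_linear "\<lambda>w. ext_deriv cyl f w z"
    by (rule ext_deriv_bounded_linear[OF cyl_subset_closure_interior assms])
  have "(s, v) = s *\<^sub>R (1, 0) + (\<Sum>j\<in>UNIV. v $ j *\<^sub>R (0, axis j 1))"
  proof -
    have "v = (\<Sum>j\<in>UNIV. v $ j *\<^sub>R axis j 1)"
      by (simp add: vec_eq_iff axis_def if_distrib cong: if_cong)
    then show ?thesis by (simp add: prod_eq_iff fst_sum snd_sum)
  qed
  then show ?thesis
    unfolding Dt_def Dx_def by (simp only: L.add L.scaleR L.sum)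
qed

lemma slice_has_derivative:
  assumes "smooth_on cyl f" "t \<in> {0..T}" "x \<in> R"
  shows "((\<lambda>y. f (t, y)) has_derivative (\<lambda>v. \<Sum>j\<in>UNIV. v $ j *\<^sub>R Dx j f (t, x))) (at x)"
proof -
  have R: "R \<subseteq> closure R" by (rule closure_subset)
  have "((\<lambda>y. f (t, y)) has_derivative (\<lambda>v. ext_deriv cyl f (0, v) (t, x))) (at x within R)"
    by (rule ext_deriv_chain[OF cyl_subset_closure_interior assms(1)])
      (use assms R in \<open>auto intro!: derivative_eq_intros\<close>)
  then show ?thesis
    using assms R at_within_open[OF assms(3) open_R] by (auto simp: ext_deriv_eq_partials)
qed

lemma time_has_vector_derivative:
  assumes "smooth_on cyl f" "t \<in> {0..T}" "x \<in> closure R"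
  shows "((\<lambda>s. f (s, x)) has_vector_derivative Dt f (t, x)) (at t within {0..T})"
proof -
  have "((\<lambda>s. f (s, x)) has_derivative (\<lambda>v. ext_deriv cyl f (v, 0) (t, x))) (at t within {0..T})"
    by (rule ext_deriv_chain[OF cyl_subset_closure_interior assms(1)])
      (use assms in \<open>auto intro!: derivative_eq_intros\<close>)
  then show ?thesis
    using assms by (auto simp: ext_deriv_eq_partials has_vector_derivative_def)
qed

lemma material_derivative_along_path:
  assumes "smooth_on cyl f" "t \<in> S" "S \<subseteq> {0..T}" "\<And>s. s \<in> S \<Longrightarrow> x s \<in> closure R"
    and "(x has_vector_derivative u t (x t)) (at t within S)"
  shows "((\<lambda>s. f (s, x s)) has_vector_derivative material f (t, x t)) (at t within S)"
proof -
  have "((\<lambda>s. f (s, x s)) has_derivative (\<lambda>v. ext_deriv cyl f (v, v *\<^sub>R u t (x t)) (t, x t))) (at t within S)"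
    by (rule ext_deriv_chain[OF cyl_subset_closure_interior assms(1)])
      (use assms in \<open>auto intro!: derivative_eq_intros simp: has_vector_derivative_def\<close>)
  moreover have "ext_deriv cyl f (v, v *\<^sub>R u t (x t)) (t, x t) = v *\<^sub>R material f (t, x t)" for v
    using assms by (subst ext_deriv_eq_partials)
      (auto simp: material_def scaleR_add_right scaleR_sum_right)
  ultimately show ?thesis by (simp add: has_vector_derivative_def)
qed

lemma vgrad_mult: "vgrad z *v v = (\<Sum>j\<in>UNIV. v $ j *\<^sub>R Dx j vel z)"
  by (simp add: vgrad_def matrix_vector_mult_def vec_eq_iff mult.commute)

lemma jacobian_eq_vgrad:
  assumes "t \<in> {0..T}" "x \<in> R"
  shows "jacobian (u t) (at x) = vgrad (t, x)"
proof -
  have "(u t has_derivative (*v) (vgrad (t, x))) (at x)"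
    using slice_has_derivative[OF vel_smooth assms] by (simp flip: vgrad_mult)
  then show ?thesis unfolding jacobian_def by (metis frechet_derivative_at matrix_of_matrix_vector_mul)
qed

lemma curl_eq_vort:
  assumes "t \<in> {0..T}" "x \<in> R"
  shows "curl (u t) x = vort (t, x)"
  by (simp add: curl_def jacobian_eq_vgrad[OF assms] vort_def curl_of_columns_eq vgrad_def Let_def)

lemma continuous_on_curl_of_columns:
  fixes S :: "'z::t2_space set"
  assumes "\<And>j. continuous_on S (c j)"
  shows "continuous_on S (\<lambda>z. curl_of_columns (\<lambda>j. c j z))"
  unfolding curl_of_columns_def by (intro continuous_intros continuous_on_cross assms)

lemma continuous_on_vort: "continuous_on cyl vort"
  unfolding vort_def [abs_def]
  by (intro continuous_on_curl_of_columns smooth_on_imp_continuous_on Dx_smooth vel_smooth)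

lemma continuous_on_vgrad_mult:
  "continuous_on cyl v \<Longrightarrow> continuous_on cyl (\<lambda>z. vgrad z *v v z)"
  unfolding vgrad_mult by (intro continuous_intros smooth_on_imp_continuous_on[OF Dx_smooth[OF vel_smooth]])

lemma continuous_on_material: "smooth_on cyl f \<Longrightarrow> continuous_on cyl (material f)"
  unfolding material_def [abs_def]
  by (intro continuous_intros smooth_on_imp_continuous_on Dt_smooth Dx_smooth vel_smooth)

lemma euler_eq:
  assumes "t \<in> {0..T}" "x \<in> R"
  shows "grad (\<pi> t) x = - (material vel (t, x) + (2 * \<Omega>) *\<^sub>R cross3 (axis 3 1) (u t x))"
    and "trace (vgrad (t, x)) = 0"
proof -
  have "vector_derivative (\<lambda>s. u s x) (at t within {0..T}) = Dt vel (t, x)"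
    by (rule vector_derivative_within_closed_interval)
      (use time_has_vector_derivative[OF vel_smooth, of t x] assms T_pos closure_subset[of R] in auto)
  moreover have "vector_derivative (\<lambda>s. u s x) (at t within {0..T})
          + jacobian (u t) (at x) *v u t x + grad (\<pi> t) x
          + (2 * \<Omega>) *\<^sub>R cross3 (axis 3 1) (u t x) = 0 \<and> divergence (u t) x = 0"
    using solution assms by (simp add: rotating_euler_solution_def)
  ultimately have e: "Dt vel (t, x) + vgrad (t, x) *v u t x + grad (\<pi> t) x
      + (2 * \<Omega>) *\<^sub>R cross3 (axis 3 1) (u t x) = 0 \<and> trace (vgrad (t, x)) = 0"
    by (simp add: jacobian_eq_vgrad[OF assms] divergence_def)
  then show "trace (vgrad (t, x)) = 0" by simp
  from e show "grad (\<pi> t) x = - (material vel (t, x) + (2 * \<Omega>) *\<^sub>R cross3 (axis 3 1) (u t x))"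
    by (simp add: material_def vgrad_mult eq_neg_iff_add_eq_0 algebra_simps)
qed

text \<open>
  By the momentum equation \<open>N j $ i\<close> is, up to sign, the derivative with respect to \<open>x\<^sub>j\<close> of the
  \<open>i\<close>-th component of the pressure gradient; hence it is symmetric.
\<close>

lemma momentum_derivative_symmetric:
  assumes t: "t \<in> {0..T}" and x: "x \<in> R"
  defines "N j \<equiv> Dx j (Dt vel) (t, x)
      + (\<Sum>k\<in>UNIV. (Dx j vel (t, x) $ k) *\<^sub>R Dx k vel (t, x) + (u t x $ k) *\<^sub>R Dx j (Dx k vel) (t, x))
      + (2 * \<Omega>) *\<^sub>R cross3 (axis 3 1) (Dx j vel (t, x))"
  shows "N j $ i = N i $ j"
proof -
  define M where "M v = (\<Sum>j\<in>UNIV. v $ j *\<^sub>R Dx j (Dt vel) (t, x))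
      + (\<Sum>k\<in>UNIV. ((\<Sum>j\<in>UNIV. v $ j *\<^sub>R Dx j vel (t, x)) $ k) *\<^sub>R Dx k vel (t, x)
           + (u t x $ k) *\<^sub>R (\<Sum>j\<in>UNIV. v $ j *\<^sub>R Dx j (Dx k vel) (t, x)))
      + (2 * \<Omega>) *\<^sub>R cross3 (axis 3 1) (\<Sum>j\<in>UNIV. v $ j *\<^sub>R Dx j vel (t, x))" for v :: "real^3"
  have "((\<lambda>y. material vel (t, y) + (2 * \<Omega>) *\<^sub>R cross3 (axis 3 1) (vel (t, y))) has_derivative M) (at x)"
    unfolding material_def
    by (rule has_derivative_eq_rhs,
        (rule derivative_intros bounded_linear.has_derivative[OF bounded_linear_vec_nth]
          bounded_linear.has_derivative[OF bounded_linear_cross_right] slice_has_derivative Dt_smooth Dx_smooth vel_smooth t x)+)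
      (simp add: M_def fun_eq_iff add.commute)
  then have "((\<lambda>y. grad (\<pi> t) y) has_derivative (\<lambda>v. - M v)) (at x)"
    by (intro has_derivative_transform_within_open[OF has_derivative_minus open_R x])
       (simp_all add: euler_eq(1)[OF t] algebra_simps)
  then have q: "((\<lambda>y. grad (\<pi> t) y $ i) has_derivative (\<lambda>v. - M v $ i)) (at x)" for i
    by (auto dest: bounded_linear.has_derivative[OF bounded_linear_vec_nth])
  have "- M (axis j 1) $ i = - M (axis i 1) $ j"
  proof (rule second_derivative_symmetric[OF open_R x, where f = "\<pi> t"
        and f' = "\<lambda>y. frechet_derivative (\<pi> t) (at y)" and v = "axis i 1" and w = "axis j 1"
        and Hv = "\<lambda>v. - M v $ i" and Hw = "\<lambda>v. - M v $ j"])
    show "(\<pi> t has_derivative frechet_derivative (\<pi> t) (at y)) (at y)" if "y \<in> R" for y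
    proof -
      have "\<pi> t differentiable_on R" using solution t by (simp add: rotating_euler_solution_def)
      then have "\<pi> t differentiable (at y)"
        using that open_R by (simp add: differentiable_on_eq_differentiable_at)
      then show ?thesis by (simp flip: frechet_derivative_works)
    qed
  qed (use q in \<open>simp_all add: grad_def\<close>)
  moreover have "M (axis j 1) = N j" for j
    by (simp add: M_def N_def axis_def if_distrib[of "\<lambda>c. c *\<^sub>R _"] cong: if_cong)
  ultimately show ?thesis by simp
qed

lemma Dx_commute:
  assumes "smooth_on cyl f" "z \<in> cyl"
  shows "Dx j (Dt f) z = Dt (Dx j f) z" "Dx j (Dx k f) z = Dx k (Dx j f) z"
  unfolding Dx_def Dt_def by (rule ext_deriv_commute[OF cyl_subset_closure_interior assms])+

text \<open>
  The material derivative of the vorticity is \<open>\<nabla>u\<close> applied to the absolute vorticity. Over \<open>R\<close> the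
  three independent instances of \<open>momentum_derivative_symmetric\<close> and the vanishing trace of \<open>\<nabla>u\<close>
  imply this by polynomial algebra. The Coriolis term contributes exactly \<open>2 \<Omega> \<nabla>u e\<^sub>3\<close>.
\<close>

lemma vorticity_transport:
  assumes "z \<in> cyl"
  shows "curl_of_columns (\<lambda>j. material (Dx j vel) z) = vgrad z *v (vort z + (2 * \<Omega>) *\<^sub>R axis 3 1)"
proof (rule eq_on_closure[where x = z and S = cyl and D = "{0..T} \<times> R"
      and f = "\<lambda>z. curl_of_columns (\<lambda>j. material (Dx j vel) z)"])
  show "continuous_on cyl (\<lambda>z. curl_of_columns (\<lambda>j. material (Dx j vel) z))"
    by (intro continuous_on_curl_of_columns continuous_on_material Dx_smooth vel_smooth)
  show "continuous_on cyl (\<lambda>z. vgrad z *v (vort z + (2 * \<Omega>) *\<^sub>R axis 3 1))"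
    by (intro continuous_on_vgrad_mult continuous_intros continuous_on_vort)
  show "{0..T} \<times> R \<subseteq> cyl" using closure_subset by auto
  show "curl_of_columns (\<lambda>j. material (Dx j vel) z) = vgrad z *v (vort z + (2 * \<Omega>) *\<^sub>R axis 3 1)"
    if "z \<in> {0..T} \<times> R" for z
  proof -
    obtain t x where z: "z = (t, x)" and tx: "t \<in> {0..T}" "x \<in> R" using \<open>z \<in> {0..T} \<times> R\<close> by auto
    have zc: "z \<in> cyl" using tx z closure_subset by auto
    define J where "J i j = Dx j vel z $ i" for i j
    define W where "W i j = material (Dx j vel) z $ i" for i j
    have sym: "W i j + (\<Sum>k\<in>UNIV. J k j * J i k) + 2 * \<Omega> * cross3 (axis 3 1) (Dx j vel z) $ i
      = W j i + (\<Sum>k\<in>UNIV. J k i * J j k) + 2 * \<Omega> * cross3 (axis 3 1) (Dx i vel z) $ j" for i j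
      using momentum_derivative_symmetric[OF tx, of j i]
      by (simp add: W_def J_def z material_def Dx_commute[OF vel_smooth zc[unfolded z]] sum.distrib algebra_simps)
    have div: "J 1 1 + J 2 2 + J 3 3 = 0"
      using euler_eq(2)[OF tx] by (simp add: trace_def vgrad_def J_def z sum_3)
    have cr: "cross3 (axis 3 1) v $ 1 = - v $ 2" "cross3 (axis 3 1) v $ 2 = v $ 1"
      "cross3 (axis 3 1) v $ 3 = 0" for v :: "real^3"
      by (simp_all add: cross3_def axis_def)
    have s: "W 3 2 + (J 1 2 * J 3 1 + J 2 2 * J 3 2 + J 3 2 * J 3 3) =
        W 2 3 + (J 1 3 * J 2 1 + J 2 3 * J 2 2 + J 3 3 * J 2 3) + 2 * \<Omega> * J 1 3"
      "W 1 3 + (J 1 3 * J 1 1 + J 2 3 * J 1 2 + J 3 3 * J 1 3) - 2 * \<Omega> * J 2 3 =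
        W 3 1 + (J 1 1 * J 3 1 + J 2 1 * J 3 2 + J 3 1 * J 3 3)"
      "W 2 1 + (J 1 1 * J 2 1 + J 2 1 * J 2 2 + J 3 1 * J 2 3) + 2 * \<Omega> * J 1 1 =
        W 1 2 + (J 1 2 * J 1 1 + J 2 2 * J 1 2 + J 3 2 * J 1 3) - 2 * \<Omega> * J 2 2"
      using sym[of 3 2] sym[of 1 3] sym[of 2 1] by (simp_all add: sum_3 cr flip: J_def)
    have "W 3 2 - W 2 3 = J 1 1 * (J 3 2 - J 2 3) + J 1 2 * (J 1 3 - J 3 1) + J 1 3 * (J 2 1 - J 1 2 + 2 * \<Omega>)"
      "W 1 3 - W 3 1 = J 2 1 * (J 3 2 - J 2 3) + J 2 2 * (J 1 3 - J 3 1) + J 2 3 * (J 2 1 - J 1 2 + 2 * \<Omega>)"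
      "W 2 1 - W 1 2 = J 3 1 * (J 3 2 - J 2 3) + J 3 2 * (J 1 3 - J 3 1) + J 3 3 * (J 2 1 - J 1 2 + 2 * \<Omega>)"
      using s div by algebra+
    then show ?thesis
      by (simp add: vec_eq_iff forall_3 curl_of_columns_eq vort_def matrix_vector_mult_def sum_3 vgrad_def
          axis_def W_def J_def)
  qed
qed (use assms cyl_eq_closure in auto)

lemma vort_has_vector_derivative:
  assumes "t \<in> S" "S \<subseteq> {0..T}" "\<And>s. s \<in> S \<Longrightarrow> x s \<in> closure R"
    and "(x has_vector_derivative u t (x t)) (at t within S)"
  shows "((\<lambda>s. vort (s, x s)) has_vector_derivative
    vgrad (t, x t) *v (vort (t, x t) + (2 * \<Omega>) *\<^sub>R axis 3 1)) (at t within S)"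
proof -
  have "((\<lambda>s. curl_of_columns (\<lambda>j. Dx j vel (s, x s))) has_vector_derivative
      curl_of_columns (\<lambda>j. material (Dx j vel) (t, x t))) (at t within S)"
    unfolding curl_of_columns_def
    by (intro has_vector_derivative_sum bounded_linear.has_vector_derivative[OF bounded_linear_cross_right]
        material_derivative_along_path Dx_smooth vel_smooth assms)
  moreover have "(t, x t) \<in> cyl" using assms by auto
  ultimately show ?thesis
    by (simp add: vorticity_transport flip: vort_def)
qed

lemma norm_vort_le:
  assumes fin: "(SUP t\<in>{0..T}. Linf_norm R (curl (u t))) < \<infinity>" and z: "z \<in> cyl"
  shows "norm (vort z) \<le> enn2real (SUP t\<in>{0..T}. Linf_norm R (curl (u t)))"
proof (rule le_on_closure[where S = cyl and D = "{0..T} \<times> R" and f = "\<lambda>z. norm (vort z)"])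
  show "continuous_on cyl (\<lambda>z. norm (vort z))" by (intro continuous_intros continuous_on_vort)
  show "{0..T} \<times> R \<subseteq> cyl" using closure_subset by auto
  show "norm (vort z) \<le> enn2real (SUP t\<in>{0..T}. Linf_norm R (curl (u t)))" if z: "z \<in> {0..T} \<times> R" for z
  proof -
    obtain t x where tx: "z = (t, x)" "t \<in> {0..T}" "x \<in> R" using z by auto
    have "ennreal (norm (curl (u t) x)) \<le> Linf_norm R (curl (u t))"
      unfolding Linf_norm_def by (rule SUP_upper) (use tx in auto)
    also have "\<dots> \<le> (SUP t\<in>{0..T}. Linf_norm R (curl (u t)))"
      by (rule SUP_upper) (use tx in auto)
    finally have "enn2real (ennreal (norm (curl (u t) x))) \<le> enn2real (SUP t\<in>{0..T}. Linf_norm R (curl (u t)))"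
      using fin by (intro enn2real_mono) auto
    then show ?thesis using tx by (simp add: curl_eq_vort)
  qed
qed (use z cyl_eq_closure in auto)

lemma norm_vgrad_mult_le:
  assumes fin: "Linf_norm_jacobian R (u t) < \<infinity>" and t: "t \<in> {0..T}" and x: "x \<in> closure R"
  shows "norm (vgrad (t, x) *v v) \<le> enn2real (Linf_norm_jacobian R (u t)) * norm v"
proof (rule le_on_closure[where S = "{t} \<times> closure R" and D = "{t} \<times> R" and f = "\<lambda>z. norm (vgrad z *v v)"])
  show "continuous_on ({t} \<times> closure R) (\<lambda>z. norm (vgrad z *v v))"
    by (intro continuous_intros continuous_on_subset[OF continuous_on_vgrad_mult]) (use t in auto)
  show "{t} \<times> R \<subseteq> {t} \<times> closure R" using closure_subset by auto
  show "norm (vgrad z *v v) \<le> enn2real (Linf_norm_jacobian R (u t)) * norm v" if "z \<in> {t} \<times> R" for z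
  proof -
    obtain y where y: "z = (t, y)" "y \<in> R" using \<open>z \<in> {t} \<times> R\<close> by auto
    have "ennreal (onorm ((*v) (jacobian (u t) (at y)))) \<le> Linf_norm_jacobian R (u t)"
      unfolding Linf_norm_jacobian_def by (rule SUP_upper) (use y in auto)
    then have "enn2real (ennreal (onorm ((*v) (jacobian (u t) (at y))))) \<le> enn2real (Linf_norm_jacobian R (u t))"
      using fin by (intro enn2real_mono) auto
    then have "onorm ((*v) (vgrad z)) \<le> enn2real (Linf_norm_jacobian R (u t))"
      using y t by (simp add: jacobian_eq_vgrad onorm_pos_le)
    moreover have "norm (vgrad z *v v) \<le> onorm ((*v) (vgrad z)) * norm v"
      by (rule onorm) (rule matrix_vector_mul_bounded_linear)
    ultimately show ?thesis by (meson mult_right_mono norm_ge_zero order_trans)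
  qed
qed (use x in \<open>auto simp: closure_Times\<close>)

section \<open>Separation of neighbouring trajectories\<close>

text \<open>
  The operator norm of the velocity gradient at a single space-time point. It is continuous along
  trajectories, so Gronwall's inequality can be used with it, whereas its supremum over \<open>R\<close> is only
  compared with it under the integral.
\<close>

definition grad_norm :: "real \<times> (real^3) \<Rightarrow> real" where
  "grad_norm z = onorm ((*v) (vgrad z))"

lemma norm_vgrad_mult_le_grad_norm: "norm (vgrad z *v v) \<le> grad_norm z * norm v"
  unfolding grad_norm_def by (rule onorm) (rule matrix_vector_mul_bounded_linear)

lemma grad_norm_nonneg: "grad_norm z \<ge> 0"
  unfolding grad_norm_def by (rule onorm_pos_le) (rule matrix_vector_mul_bounded_linear)

lemma continuous_on_grad_norm: "continuous_on cyl grad_norm"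
proof -
  define G where "G z = Blinfun ((*v) (vgrad z))" for z
  have G: "blinfun_apply (G z) = (*v) (vgrad z)" for z
    unfolding G_def by (rule bounded_linear_Blinfun_apply) (rule matrix_vector_mul_bounded_linear)
  have "continuous_on cyl G"
    by (rule continuous_on_blinfun_componentwise) (auto simp: G intro!: continuous_on_vgrad_mult)
  moreover have "grad_norm = (\<lambda>z. norm (G z))" by (simp add: fun_eq_iff norm_blinfun.rep_eq G grad_norm_def)
  ultimately show ?thesis by (simp only: continuous_on_norm)
qed

lemma grad_norm_le_Linf_norm_jacobian:
  assumes "t \<in> {0..T}" "x \<in> closure R"
  shows "ennreal (grad_norm (t, x)) \<le> Linf_norm_jacobian R (u t)"
proof (cases "Linf_norm_jacobian R (u t) = top")
  case False
  then have fin: "Linf_norm_jacobian R (u t) < \<infinity>"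
    unfolding infinity_ennreal_def less_top[symmetric] .
  have "grad_norm (t, x) \<le> enn2real (Linf_norm_jacobian R (u t))"
    unfolding grad_norm_def by (rule onorm_bound[OF enn2real_nonneg norm_vgrad_mult_le[OF fin assms]])
  then have "ennreal (grad_norm (t, x)) \<le> ennreal (enn2real (Linf_norm_jacobian R (u t)))"
    by (rule ennreal_leI)
  also have "\<dots> = Linf_norm_jacobian R (u t)" using fin by (intro ennreal_enn2real) auto
  finally show ?thesis .
qed simp

definition trajectory :: "real \<Rightarrow> (real \<Rightarrow> real^3) \<Rightarrow> bool" where
  "trajectory t0 x \<longleftrightarrow> (\<forall>t\<in>{t0..T}. x t \<in> closure R \<and>
     (x has_vector_derivative u t (x t)) (at t within {t0..T}))"

lemma trajectory_continuous_on: "trajectory t0 x \<Longrightarrow> continuous_on {t0..T} x"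
  unfolding trajectory_def continuous_on_eq_continuous_within
  using has_vector_derivative_continuous by blast

lemma trajectory_restrict:
  assumes "trajectory t0 x" "t1 \<le> T" "t \<in> {t0..t1}"
  shows "(x has_vector_derivative u t (x t)) (at t within {t0..t1})"
  by (rule has_vector_derivative_within_subset[of _ _ _ "{t0..T}"])
    (use assms in \<open>auto simp: trajectory_def\<close>)

lemma continuous_on_grad_norm_trajectory:
  assumes "trajectory t0 x" "0 \<le> t0"
  shows "continuous_on {t0..T} (\<lambda>s. grad_norm (s, x s))"
proof -
  have "continuous_on {t0..T} (\<lambda>s. (s, x s))"
    by (intro continuous_intros trajectory_continuous_on[OF assms(1)])
  then show ?thesis
    by (rule continuous_on_compose2[OF continuous_on_grad_norm]) (use assms in \<open>auto simp: trajectory_def\<close>)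
qed

text \<open>
  A trajectory over the compact time interval has a tube in which \<open>u\<close> is uniformly close to its
  linearization at the trajectory.
\<close>

lemma velocity_linearization_near_trajectory:
  assumes x: "trajectory t0 x" and "0 \<le> t0" and "\<epsilon> > 0"
  shows "\<exists>r>0. \<forall>t\<in>{t0..T}. \<forall>y\<in>closure R. norm (y - x t) < r \<longrightarrow>
    norm (u t y - u t (x t) - vgrad (t, x t) *v (y - x t)) \<le> \<epsilon> * norm (y - x t)"
proof -
  let ?K = "(\<lambda>t. (t, x t)) ` {t0..T}"
  have cK: "compact ?K"
    by (intro compact_continuous_image continuous_intros trajectory_continuous_on[OF x]) auto
  have K: "?K \<subseteq> cyl" using x \<open>0 \<le> t0\<close> by (auto simp: trajectory_def)
  obtain r where r: "r > 0" "\<forall>z\<in>?K. \<forall>w\<in>cyl \<inter> ball z r.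
      norm (vel w - vel z - ext_deriv cyl vel (w - z) z) \<le> \<epsilon> * norm (w - z)"
    using ext_deriv_uniform_on_compact[OF cyl_subset_closure_interior vel_smooth cK K \<open>\<epsilon> > 0\<close>] by blast
  show ?thesis
  proof (intro exI[of _ r] conjI ballI impI r(1))
    fix t y assume t: "t \<in> {t0..T}" and y: "y \<in> closure R" "norm (y - x t) < r"
    have "(t, y) \<in> cyl \<inter> ball (t, x t) r"
      using t y \<open>0 \<le> t0\<close> by (auto simp: dist_Pair_Pair dist_norm norm_minus_commute)
    then have "norm (u t y - u t (x t) - ext_deriv cyl vel ((t, y) - (t, x t)) (t, x t))
      \<le> \<epsilon> * norm ((t, y) - (t, x t))"
      using bspec[OF bspec[OF r(2), of "(t, x t)"], of "(t, y)"] t by simp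
    moreover have "ext_deriv cyl vel ((t, y) - (t, x t)) (t, x t) = vgrad (t, x t) *v (y - x t)"
      using K t by (simp add: ext_deriv_eq_partials[OF vel_smooth] vgrad_mult image_subset_iff del: mem_Times_iff)
    ultimately show "norm (u t y - u t (x t) - vgrad (t, x t) *v (y - x t)) \<le> \<epsilon> * norm (y - x t)"
      by (simp add: norm_Pair)
  qed
qed

text \<open>
  The separation of a nearby trajectory satisfies the linearized equation up to an error that is
  small relative to its initial value. The linearization is valid only inside a tube around \<open>x\<close>, so a
  continuity argument is needed first: until a trajectory leaves the tube, its distance to \<open>x\<close> grows
  at most by a fixed exponential factor, so it never leaves if it starts close enough.
\<close>

lemma neighbouring_trajectories:
  assumes x: "trajectory t0 x" and t0: "0 \<le> t0" "t0 \<le> T" and "\<epsilon> > 0"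
  shows "\<exists>\<eta>>0. \<forall>y. trajectory t0 y \<longrightarrow> norm (y t0 - x t0) < \<eta> \<longrightarrow> (\<forall>t\<in>{t0..T}.
    norm (u t (y t) - u t (x t) - vgrad (t, x t) *v (y t - x t)) \<le> \<epsilon> * norm (y t0 - x t0))"
proof -
  obtain B where B: "\<And>t. t \<in> {t0..T} \<Longrightarrow> grad_norm (t, x t) \<le> B"
    using continuous_attains_sup[OF compact_Icc _ continuous_on_grad_norm_trajectory[OF x t0(1)]] t0(2)
    by (metis atLeastatMost_empty_iff2)
  define L where "L = B + 1"
  have "0 \<le> L" using B[of t0] grad_norm_nonneg[of "(t0, x t0)"] t0 by (simp add: L_def)
  define E where "E = exp (L * (T - t0))"
  have "E > 0" by (simp add: E_def)
  obtain r1 where r1: "r1 > 0" "\<And>t y. t \<in> {t0..T} \<Longrightarrow> y \<in> closure R \<Longrightarrow> norm (y - x t) < r1 \<Longrightarrow>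
    norm (u t y - u t (x t) - vgrad (t, x t) *v (y - x t)) \<le> 1 * norm (y - x t)"
    using velocity_linearization_near_trajectory[OF x t0(1), of 1] by auto
  obtain r2 where r2: "r2 > 0" "\<And>t y. t \<in> {t0..T} \<Longrightarrow> y \<in> closure R \<Longrightarrow> norm (y - x t) < r2 \<Longrightarrow>
    norm (u t y - u t (x t) - vgrad (t, x t) *v (y - x t)) \<le> \<epsilon> / E * norm (y - x t)"
    using velocity_linearization_near_trajectory[OF x t0(1), of "\<epsilon> / E"] \<open>\<epsilon> > 0\<close> \<open>E > 0\<close> by auto
  \<comment> \<open>halved so that both estimates still hold at distance exactly \<open>r\<close>, the value at the first exit\<close>
  define r where "r = min r1 r2 / 2"
  have r: "r > 0" "r < r1" "r < r2" using r1(1) r2(1) by (auto simp: r_def)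
  show ?thesis
  proof (intro exI[of _ "r / E"] conjI allI impI)
    show "r / E > 0" using r \<open>E > 0\<close> by simp
    fix y assume y: "trajectory t0 y" and small: "norm (y t0 - x t0) < r / E"
    define \<delta> where "\<delta> t = y t - x t" for t
    have \<delta>small: "norm (\<delta> t0) * E < r" using small \<open>E > 0\<close> by (simp add: \<delta>_def field_simps)
    have cont: "continuous_on {t0..T} (\<lambda>t. norm (\<delta> t))"
      unfolding \<delta>_def by (intro continuous_intros trajectory_continuous_on x y)
    have grow: "norm (\<delta> t) \<le> norm (\<delta> t0) * E"
      if t: "t \<in> {t0..T}" and close: "\<And>s. s \<in> {t0..t} \<Longrightarrow> norm (\<delta> s) \<le> r" for t
    proof -
      have "norm (\<delta> t) \<le> (norm (\<delta> t0) + 0 * (t - t0)) * exp (integral {t0..t} (\<lambda>_. L))"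
      proof (rule gronwall_norm[where e' = "\<lambda>s. u s (y s) - u s (x s)"])
        fix s assume s: "s \<in> {t0..t}"
        show "(\<delta> has_vector_derivative u s (y s) - u s (x s)) (at s within {t0..t})"
          unfolding \<delta>_def using t s by (intro derivative_intros trajectory_restrict x y) auto
        have s': "s \<in> {t0..T}" using s t by auto
        have "norm (u s (y s) - u s (x s) - vgrad (s, x s) *v \<delta> s) \<le> 1 * norm (\<delta> s)"
          unfolding \<delta>_def using close[OF s] r(2) y s' by (intro r1(2)) (auto simp: trajectory_def \<delta>_def)
        moreover have "norm (vgrad (s, x s) *v \<delta> s) \<le> B * norm (\<delta> s)"
          using norm_vgrad_mult_le_grad_norm B[OF s'] by (meson mult_right_mono norm_ge_zero order_trans)
        moreover have "norm (u s (y s) - u s (x s)) \<le>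
            norm (u s (y s) - u s (x s) - vgrad (s, x s) *v \<delta> s) + norm (vgrad (s, x s) *v \<delta> s)"
          by (metis diff_add_cancel norm_triangle_ineq)
        ultimately show "norm (u s (y s) - u s (x s)) \<le> L * norm (\<delta> s) + 0"
          by (simp add: L_def algebra_simps)
      qed (use t \<open>0 \<le> L\<close> in auto)
      also have "\<dots> \<le> norm (\<delta> t0) * E"
        using t \<open>0 \<le> L\<close> by (auto simp: E_def mult.commute[of L] intro!: mult_left_mono mult_right_mono)
      finally show ?thesis .
    qed
    have inside: "norm (\<delta> t) < r" if "t \<in> {t0..T}" for t
    proof (rule ccontr)
      assume "\<not> norm (\<delta> t) < r"
      \<comment> \<open>its least element is the first time at which the distance reaches \<open>r\<close>\<close>
      define Z where "Z = {s \<in> {t0..T}. r \<le> norm (\<delta> s)}"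
      have "Z = {t0..T} \<inter> (\<lambda>s. norm (\<delta> s)) -` {r..}" by (auto simp: Z_def)
      then have "closed Z"
        using continuous_closed_preimage[OF cont closed_real_atLeastAtMost closed_atLeast] by simp
      then have "compact Z"
        using bounded_subset[OF bounded_closed_interval[of t0 T], of Z]
        unfolding compact_eq_bounded_closed by (simp add: Z_def subset_eq)
      moreover have "t \<in> Z" using that \<open>\<not> norm (\<delta> t) < r\<close> by (auto simp: Z_def)
      ultimately obtain s where s: "s \<in> Z" "\<And>w. w \<in> Z \<Longrightarrow> s \<le> w"
        using compact_attains_inf[of Z] by blast
      have "1 \<le> E" using t0 \<open>0 \<le> L\<close> by (simp add: E_def)
      then have "norm (\<delta> t0) * 1 \<le> norm (\<delta> t0) * E" by (intro mult_left_mono) auto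
      then have "norm (\<delta> t0) \<le> r" using \<delta>small by simp
      then obtain w where w: "t0 \<le> w" "w \<le> s" "norm (\<delta> w) = r"
        using IVT'[of "\<lambda>t. norm (\<delta> t)" t0 r s] s(1) continuous_on_subset[OF cont, of "{t0..s}"]
        by (auto simp: Z_def)
      then have "w = s" using s by (intro antisym) (auto simp: Z_def)
      have "norm (\<delta> s) \<le> norm (\<delta> t0) * E"
      proof (rule grow)
        show "s \<in> {t0..T}" using s by (simp add: Z_def)
        show "norm (\<delta> v) \<le> r" if "v \<in> {t0..s}" for v
          using s that w \<open>w = s\<close> by (cases "v \<in> Z") (force simp: Z_def)+
      qed
      then show False using \<delta>small w \<open>w = s\<close> by simp
    qed
    show "\<forall>t\<in>{t0..T}. norm (u t (y t) - u t (x t) - vgrad (t, x t) *v (y t - x t)) \<le> \<epsilon> * norm (y t0 - x t0)"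
    proof
      fix t assume t: "t \<in> {t0..T}"
      have "norm (u t (y t) - u t (x t) - vgrad (t, x t) *v (y t - x t)) \<le> \<epsilon> / E * norm (\<delta> t)"
        unfolding \<delta>_def using inside[OF t] r(3) y t by (intro r2(2)) (auto simp: trajectory_def \<delta>_def)
      also have "\<dots> \<le> \<epsilon> / E * (norm (\<delta> t0) * E)"
        using t \<open>\<epsilon> > 0\<close> \<open>E > 0\<close> by (intro mult_left_mono grow less_imp_le[OF inside]) auto
      also have "\<dots> = \<epsilon> * norm (y t0 - x t0)" using \<open>E > 0\<close> by (simp add: \<delta>_def)
      finally show "norm (u t (y t) - u t (x t) - vgrad (t, x t) *v (y t - x t)) \<le> \<epsilon> * norm (y t0 - x t0)" .
    qed
  qed
qed

text \<open>
  The nonnegative integral is monotone for arbitrary integrands, so the supremum norm can be compared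
  with \<open>grad_norm\<close> without discussing how it depends on time.
\<close>

lemma integral_grad_norm_le:
  assumes x: "trajectory t0 x" and t: "0 \<le> t0" "t \<in> {t0..T}"
    and fin: "(\<integral>\<^sup>+ s\<in>{t0..t}. Linf_norm_jacobian R (u s) \<partial>lborel) < \<infinity>"
  shows "integral {t0..t} (\<lambda>s. grad_norm (s, x s)) \<le> enn2real (\<integral>\<^sup>+ s\<in>{t0..t}. Linf_norm_jacobian R (u s) \<partial>lborel)"
proof -
  have int: "(\<lambda>s. grad_norm (s, x s)) integrable_on {t0..t}"
    by (intro integrable_continuous_real continuous_on_subset[OF continuous_on_grad_norm_trajectory[OF x t(1)]])
      (use t in auto)
  have "ennreal (integral {t0..t} (\<lambda>s. grad_norm (s, x s))) = (\<integral>\<^sup>+ s\<in>{t0..t}. ennreal (grad_norm (s, x s)) \<partial>lborel)"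
    by (rule nn_integral_has_integral_lebesgue'[symmetric]) (auto intro!: grad_norm_nonneg integrable_integral int)
  also have "\<dots> \<le> (\<integral>\<^sup>+ s\<in>{t0..t}. Linf_norm_jacobian R (u s) \<partial>lborel)"
    by (rule nn_integral_mono)
      (use x t in \<open>auto simp: indicator_def trajectory_def intro!: grad_norm_le_Linf_norm_jacobian\<close>)
  finally have "enn2real (ennreal (integral {t0..t} (\<lambda>s. grad_norm (s, x s)))) \<le>
      enn2real (\<integral>\<^sup>+ s\<in>{t0..t}. Linf_norm_jacobian R (u s) \<partial>lborel)"
    using fin by (intro enn2real_mono) auto
  then show ?thesis using integral_nonneg[OF int] grad_norm_nonneg by simp
qed

text \<open>
  The core of the argument: \<open>h / (2 \<Omega>) \<zeta>\<close> and the separation solve the same linear equation up to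
  \<open>o(h)\<close>, and for a vertical initial separation \<open>h e\<^sub>3\<close> the initial difference is only
  \<open>h / (2 \<Omega>) curl u\<close>.
\<close>

lemma vertical_separation_infinitesimal:
  assumes x: "trajectory t0 x" and t: "0 \<le> t0" "t \<in> {t0..T}" and "\<Omega> > 0" and "\<epsilon> > 0"
    and V: "\<And>z. z \<in> cyl \<Longrightarrow> norm (vort z) \<le> V"
    and I: "integral {t0..t} (\<lambda>s. grad_norm (s, x s)) \<le> I"
  shows "\<exists>\<eta>>0. \<forall>y h. trajectory t0 y \<longrightarrow> y t0 = x t0 + h *\<^sub>R axis 3 1 \<longrightarrow> \<bar>h\<bar> < \<eta> \<longrightarrow>
    \<bar>y t $ 3 - x t $ 3 - h\<bar> \<le> (V / (2 * \<Omega>) * (1 + exp I) + \<epsilon>) * \<bar>h\<bar>"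
proof -
  \<comment> \<open>the summand \<open>1\<close> keeps the denominator positive when \<open>t = t0\<close>\<close>
  define \<epsilon>' where "\<epsilon>' = \<epsilon> / ((t - t0 + 1) * exp I)"
  have "\<epsilon>' > 0" using t \<open>\<epsilon> > 0\<close> by (simp add: \<epsilon>'_def)
  have "t0 \<le> T" using t by auto
  from neighbouring_trajectories[OF x t(1) this \<open>\<epsilon>' > 0\<close>] obtain \<eta> where \<eta>: "\<eta> > 0"
    "\<And>y s. trajectory t0 y \<Longrightarrow> norm (y t0 - x t0) < \<eta> \<Longrightarrow> s \<in> {t0..T} \<Longrightarrow>
      norm (u s (y s) - u s (x s) - vgrad (s, x s) *v (y s - x s)) \<le> \<epsilon>' * norm (y t0 - x t0)"
    by blast
  show ?thesis
  proof (intro exI[of _ \<eta>] conjI allI impI \<eta>(1))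
    fix y h assume y: "trajectory t0 y" "y t0 = x t0 + h *\<^sub>R axis 3 1" and h: "\<bar>h\<bar> < \<eta>"
    define \<zeta> where "\<zeta> s = vort (s, x s) + (2 * \<Omega>) *\<^sub>R axis 3 1" for s
    define e where "e s = (h / (2 * \<Omega>)) *\<^sub>R \<zeta> s - (y s - x s)" for s
    define e' where "e' s = (h / (2 * \<Omega>)) *\<^sub>R (vgrad (s, x s) *v \<zeta> s) - (u s (y s) - u s (x s))" for s
    have cyl: "(s, x s) \<in> cyl" if "s \<in> {t0..T}" for s
      using that x t by (auto simp: trajectory_def)
    have "norm (e t) \<le> (norm (e t0) + \<epsilon>' * \<bar>h\<bar> * (t - t0)) * exp (integral {t0..t} (\<lambda>s. grad_norm (s, x s)))"
    proof (rule gronwall_norm[where e' = e'])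
      fix s assume s: "s \<in> {t0..t}"
      have "((\<lambda>s. vort (s, x s)) has_vector_derivative vgrad (s, x s) *v \<zeta> s) (at s within {t0..t})"
        unfolding \<zeta>_def by (rule vort_has_vector_derivative)
          (use s t x trajectory_restrict[OF x _ s] in \<open>auto simp: trajectory_def\<close>)
      then have d\<zeta>: "(\<zeta> has_vector_derivative vgrad (s, x s) *v \<zeta> s) (at s within {t0..t})"
        unfolding \<zeta>_def by (auto intro!: derivative_eq_intros)
      show "(e has_vector_derivative e' s) (at s within {t0..t})"
        unfolding e_def e'_def
        by (intro has_vector_derivative_diff bounded_linear.has_vector_derivative[OF bounded_linear_scaleR_right]
            d\<zeta> trajectory_restrict x y(1) s) (use t in auto)
      have "e' s = vgrad (s, x s) *v e s - (u s (y s) - u s (x s) - vgrad (s, x s) *v (y s - x s))"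
        by (simp add: e_def e'_def matrix_vector_mult_diff_distrib matrix_vector_mult_scaleR)
      then have "norm (e' s) \<le> norm (vgrad (s, x s) *v e s)
          + norm (u s (y s) - u s (x s) - vgrad (s, x s) *v (y s - x s))"
        using norm_triangle_ineq4 by metis
      also have "\<dots> \<le> grad_norm (s, x s) * norm (e s) + \<epsilon>' * \<bar>h\<bar>"
        using \<eta>(2)[OF y(1), of s] h s t y(2) by (intro add_mono norm_vgrad_mult_le_grad_norm) auto
      finally show "norm (e' s) \<le> grad_norm (s, x s) * norm (e s) + \<epsilon>' * \<bar>h\<bar>" .
    qed (use t \<open>\<epsilon>' > 0\<close> grad_norm_nonneg in
        \<open>auto intro!: continuous_on_subset[OF continuous_on_grad_norm_trajectory[OF x t(1)]]\<close>)
    also have "\<dots> \<le> (norm (e t0) + \<epsilon>' * \<bar>h\<bar> * (t - t0)) * exp I"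
      using t \<open>\<epsilon>' > 0\<close> I by (intro mult_left_mono add_nonneg_nonneg) auto
    also have "\<dots> \<le> (V / (2 * \<Omega>) * \<bar>h\<bar> + \<epsilon>' * \<bar>h\<bar> * (t - t0 + 1)) * exp I"
    proof -
      have "e t0 = (h / (2 * \<Omega>)) *\<^sub>R vort (t0, x t0)"
        using \<open>\<Omega> > 0\<close> by (simp add: e_def \<zeta>_def y(2) scaleR_add_right)
      then have "norm (e t0) = \<bar>h\<bar> / (2 * \<Omega>) * norm (vort (t0, x t0))"
        using \<open>\<Omega> > 0\<close> by simp
      also have "\<dots> \<le> \<bar>h\<bar> / (2 * \<Omega>) * V"
        using V[OF cyl, of t0] t \<open>\<Omega> > 0\<close> by (intro mult_left_mono) auto
      finally have "norm (e t0) \<le> V / (2 * \<Omega>) * \<bar>h\<bar>" by (simp add: mult.commute)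
      moreover have "\<epsilon>' * \<bar>h\<bar> * (t - t0) \<le> \<epsilon>' * \<bar>h\<bar> * (t - t0 + 1)"
        using \<open>\<epsilon>' > 0\<close> by (intro mult_left_mono) auto
      ultimately show ?thesis by (intro mult_right_mono add_mono) auto
    qed
    also have "\<dots> = V / (2 * \<Omega>) * \<bar>h\<bar> * exp I + \<epsilon> * \<bar>h\<bar>"
    proof -
      have "\<epsilon>' * ((t - t0 + 1) * exp I) = \<epsilon>" using t by (simp add: \<epsilon>'_def)
      then have "\<epsilon> * \<bar>h\<bar> = \<epsilon>' * ((t - t0 + 1) * exp I) * \<bar>h\<bar>" by simp
      then show ?thesis by (simp add: algebra_simps)
    qed
    finally have e: "norm (e t) \<le> V / (2 * \<Omega>) * \<bar>h\<bar> * exp I + \<epsilon> * \<bar>h\<bar>" .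
    have "y t $ 3 - x t $ 3 - h = h / (2 * \<Omega>) * vort (t, x t) $ 3 - e t $ 3"
      using \<open>\<Omega> > 0\<close> by (simp add: e_def \<zeta>_def field_simps)
    also have "\<bar>\<dots>\<bar> \<le> \<bar>h / (2 * \<Omega>) * vort (t, x t) $ 3\<bar> + \<bar>e t $ 3\<bar>" by (rule abs_triangle_ineq4)
    also have "\<dots> \<le> \<bar>h\<bar> / (2 * \<Omega>) * V + norm (e t)"
    proof (rule add_mono)
      have "\<bar>vort (t, x t) $ 3\<bar> \<le> V"
        using component_le_norm_cart[of "vort (t, x t)" 3] V[OF cyl[OF t(2)]] by linarith
      then have "\<bar>h\<bar> / (2 * \<Omega>) * \<bar>vort (t, x t) $ 3\<bar> \<le> \<bar>h\<bar> / (2 * \<Omega>) * V"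
        using \<open>\<Omega> > 0\<close> by (intro mult_left_mono) auto
      then show "\<bar>h / (2 * \<Omega>) * vort (t, x t) $ 3\<bar> \<le> \<bar>h\<bar> / (2 * \<Omega>) * V"
        using \<open>\<Omega> > 0\<close> by (simp add: abs_mult)
    qed (rule component_le_norm_cart)
    also have "\<dots> \<le> (V / (2 * \<Omega>) * (1 + exp I) + \<epsilon>) * \<bar>h\<bar>"
      using e by (simp add: algebra_simps add_divide_distrib)
    finally show "\<bar>y t $ 3 - x t $ 3 - h\<bar> \<le> (V / (2 * \<Omega>) * (1 + exp I) + \<epsilon>) * \<bar>h\<bar>" .
  qed
qed

end

section \<open>Vertical separation at finite distance\<close>

theorem theorem4:
  fixes \<Omega> T t0 a b c d \<rho> :: real
    and R :: "(real^3) set"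
    and n :: "real^3 \<Rightarrow> real^3"
    and u :: "real \<Rightarrow> real^3 \<Rightarrow> real^3"
    and \<pi> :: "real \<Rightarrow> real^3 \<Rightarrow> real"
    and X :: "real^3 \<Rightarrow> real \<Rightarrow> real^3"
    and P Q :: "real^3"
  assumes "\<Omega> > 0" and "T > 0"
    and "open R" and "connected R" and "smooth_boundary R" and "outward_unit_normal R n"
    and "rotating_euler_solution \<Omega> T R u \<pi>"
    and "\<forall>t\<in>{0..T}. \<forall>p\<in>frontier R. u t p \<bullet> n p = 0"
    and "(SUP t\<in>{0..T}. Linf_norm R (curl (u t))) < \<infinity>"
    and "(\<integral>\<^sup>+ t\<in>{0..T}. Linf_norm_jacobian R (u t) \<partial>lborel) < \<infinity>"
    and "t0 \<in> {0..T}"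
    and "lagrangian_path_map R u t0 T X"
    and "d > 0"
    and "P = vector [a, b, c]" and "Q = vector [a, b, c + d]"
    and "closed_segment P Q \<subseteq> R"
    and "\<rho> = enn2real (SUP t\<in>{0..T}. Linf_norm R (curl (u t))) / \<Omega>"
  shows "\<forall>t\<in>{t0..T}.
    \<bar>X P t $ 3 - X Q t $ 3 + d\<bar>
      \<le> \<rho> * d / 2 *
        (1 + exp (2 * enn2real (\<integral>\<^sup>+ t'\<in>{t0..t}. Linf_norm_jacobian R (u t') \<partial>lborel)))"
proof
  fix t assume t: "t \<in> {t0..T}"
  interpret rotating_euler_flow \<Omega> T R u \<pi> by unfold_locales (rule assms)+
  define V where "V = enn2real (SUP t\<in>{0..T}. Linf_norm R (curl (u t)))"
  define N where "N = (\<integral>\<^sup>+ t'\<in>{t0..t}. Linf_norm_jacobian R (u t') \<partial>lborel)"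
  define I where "I = enn2real N"
  define p where "p s = P + s *\<^sub>R axis 3 1" for s :: real
  have Q: "Q = p d" by (simp add: p_def assms(14,15) vec_eq_iff forall_3 axis_def)
  have V: "norm (vort z) \<le> V" if "z \<in> cyl" for z
    unfolding V_def by (rule norm_vort_le[OF assms(9) that])
  have "N \<le> (\<integral>\<^sup>+ t\<in>{0..T}. Linf_norm_jacobian R (u t) \<partial>lborel)"
    unfolding N_def by (rule nn_integral_mono) (use t assms(11) in \<open>auto simp: indicator_def\<close>)
  then have fin: "N < \<infinity>" using assms(10) by (rule le_less_trans)
  have pR: "p s \<in> R" if "s \<in> {0..d}" for s
  proof -
    have "p s = (1 - s / d) *\<^sub>R P + (s / d) *\<^sub>R Q"
      using assms(13) by (simp add: Q p_def algebra_simps)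
    then have "p s \<in> closed_segment P Q"
      unfolding closed_segment_def using that assms(13) by (auto intro!: exI[of _ "s / d"])
    then show ?thesis using assms(16) by auto
  qed
  have traj: "trajectory t0 (X (p s))" "X (p s) t0 = p s" if "s \<in> {0..d}" for s
    using assms(12) pR[OF that] by (auto simp: lagrangian_path_map_def trajectory_def)
  have "\<bar>(X (p d) t $ 3 - d) - (X (p 0) t $ 3 - 0)\<bar> \<le> V / (2 * \<Omega>) * (1 + exp I) * (d - 0)"
  proof (rule local_lipschitz_bound_imp_bound)
    fix s \<epsilon> :: real assume s: "s \<in> {0..d}" and "\<epsilon> > 0"
    have "integral {t0..t} (\<lambda>\<tau>. grad_norm (\<tau>, X (p s) \<tau>)) \<le> I"
      unfolding I_def N_def
      by (rule integral_grad_norm_le[OF traj(1)[OF s] _ t]) (use assms(11) fin in \<open>auto simp: N_def\<close>)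
    from vertical_separation_infinitesimal[OF traj(1)[OF s] _ t \<open>\<Omega> > 0\<close> \<open>\<epsilon> > 0\<close> V this]
    obtain \<eta> where \<eta>: "\<eta> > 0" "\<And>y h. trajectory t0 y \<Longrightarrow> y t0 = X (p s) t0 + h *\<^sub>R axis 3 1 \<Longrightarrow> \<bar>h\<bar> < \<eta> \<Longrightarrow>
        \<bar>y t $ 3 - X (p s) t $ 3 - h\<bar> \<le> (V / (2 * \<Omega>) * (1 + exp I) + \<epsilon>) * \<bar>h\<bar>"
      using assms(11) by auto
    show "\<exists>r>0. \<forall>s'\<in>{0..d}. \<bar>s' - s\<bar> < r \<longrightarrow>
        \<bar>(X (p s') t $ 3 - s') - (X (p s) t $ 3 - s)\<bar> \<le> (V / (2 * \<Omega>) * (1 + exp I) + \<epsilon>) * \<bar>s' - s\<bar>"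
    proof (intro exI[of _ \<eta>] conjI ballI impI \<eta>(1))
      fix s' assume s': "s' \<in> {0..d}" "\<bar>s' - s\<bar> < \<eta>"
      have "X (p s') t0 = X (p s) t0 + (s' - s) *\<^sub>R axis 3 1"
        using traj(2)[OF s] traj(2)[OF s'(1)] by (simp add: p_def algebra_simps)
      from \<eta>(2)[OF traj(1)[OF s'(1)] this s'(2)]
      show "\<bar>(X (p s') t $ 3 - s') - (X (p s) t $ 3 - s)\<bar> \<le> (V / (2 * \<Omega>) * (1 + exp I) + \<epsilon>) * \<bar>s' - s\<bar>"
        by (simp add: algebra_simps)
    qed
  qed (use assms(13) in auto)
  moreover have "p 0 = P" by (simp add: p_def)
  ultimately have "\<bar>X P t $ 3 - X Q t $ 3 + d\<bar> \<le> V / (2 * \<Omega>) * (1 + exp I) * d"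
    by (simp add: Q abs_minus_commute algebra_simps)
  \<comment> \<open>the exponent \<open>I\<close> already suffices, and \<open>I \<ge> 0\<close> gives \<open>2 I\<close>\<close>
  also have "\<dots> \<le> V / (2 * \<Omega>) * (1 + exp (2 * I)) * d"
    using \<open>\<Omega> > 0\<close> \<open>d > 0\<close> by (intro mult_right_mono mult_left_mono add_mono) (auto simp: V_def I_def)
  also have "\<dots> = \<rho> * d / 2 * (1 + exp (2 * I))"
    using \<open>\<Omega> > 0\<close> by (simp add: assms(17) V_def field_simps)
  finally show "\<bar>X P t $ 3 - X Q t $ 3 + d\<bar> \<le> \<rho> * d / 2 * (1 + exp (2 * enn2real (\<integral>\<^sup>+ t'\<in>{t0..t}. Linf_norm_jacobian R (u t') \<partial>lborel)))"
    by (simp add: I_def N_def)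
qed

end
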